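(* Let $\mathcal{C}$ be an idempotent-pure coverage on an inverse semigroup $S$ with zero. Then the map $A\mapsto\overline{A}$ defines a nucleus on the pseudogroup $C(S)$, and $\iota\colon S\to C(S,\mathcal{C})$, $\iota(s)=\overline{s^{\downarrow}}$, is a $\mathcal{C}$-cover-to-join map which is universal amongst such maps to pseudogroups: for every $\mathcal{C}$-cover-to-join map $\theta\colon S\to T$ to a pseudogroup $T$ there is a unique pseudogroup morphism $\bar\theta\colon C(S,\mathcal{C})\to T$ with $\bar\theta\iota=\theta$.
   Context: Inverse semigroups carry their natural partial order; $E(S)$ is the set of idempotents of $S$; $a^{\downarrow}=\{y:y\le a\}$. Semigroups have a zero, homomorphisms preserve it, and order ideals (downward closed subsets) contain it. Elements $s,t$ are compatible if $s^{-1}t$ and $st^{-1}$ are idempotents. A pseudogroup is an inverse monoid in which every compatible subset has a join and multiplication distributes over arbitrary compatible joins; a pseudogroup morphism is a semigroup homomorphism preserving compatible joins. A coverage $\mathcal{C}$ on $S$ assigns to each $a\in S$ a set $\mathcal{C}(a)$ of subsets of $a^{\downarrow}$ such that: (R) $\{a\}\in\mathcal{C}(a)$; (I) $X\in\mathcal{C}(a)$ implies $X^{-1}\in\mathcal{C}(a^{-1})$; (MS) $X\in\mathcal{C}(a)$ and $Y\in\mathcal{C}(b)$ imply $XY\in\mathcal{C}(ab)$; (T) if $X\in\mathcal{C}(a)$ and $X_i\in\mathcal{C}(x_i)$ for each $x_i\in X$ then $\bigcup_i X_i\in\mathcal{C}(a)$. It is idempotent-pure if $X\in\mathcal{C}(a)$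 and $X\subseteq E(S)$ imply that $a$ is idempotent. A semigroup homomorphism $\theta\colon S\to T$ to a pseudogroup is a $\mathcal{C}$-cover-to-join map if $\theta(a)=\bigvee_{x\in X}\theta(x)$ for all $a\in S$ and $X\in\mathcal{C}(a)$. $C(S)$ is the pseudogroup of all compatible order ideals of $S$ under subset multiplication (its order is inclusion). For $A\in C(S)$, $\overline{A}=\{x\in S:\text{there is } X\subseteq A \text{ with } X\in\mathcal{C}(x)\}$. A nucleus on an inverse semigroup $P$ is a map $\nu\colon P\to P$ such that $a\le\nu(a)$; $a\le b$ implies $\nu(a)\le\nu(b)$; $\nu^2=\nu$; and $\nu(a)\nu(b)\le\nu(ab)$. A subset $A\subseteq S$ is $\mathcal{C}$-closed if $X\subseteq A$ and $X\in\mathcal{C}(x)$ imply $x\in A$. $C(S,\mathcal{C})$ is the set of $\mathcal{C}$-closed elements of $C(S)$ with product $A\cdot B=\overline{AB}$; it is a pseudogroup ordered by inclusion. *)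

theory Defs
  imports "HOL-Algebra.Congruence"
begin

section \<open>Inverse semigroups with zero\<close>

record 'a zsemigroup = "'a partial_object" +
  smult :: "'a \<Rightarrow> 'a \<Rightarrow> 'a" (infixl \<open>\<cdot>\<index>\<close> 70)
  szero :: 'a (\<open>\<o>\<index>\<close>)

locale inverse_semigroup =
  fixes S (structure)
  assumes mult_closed: "\<lbrakk>a \<in> carrier S; b \<in> carrier S\<rbrakk> \<Longrightarrow> a \<cdot> b \<in> carrier S"
    and mult_assoc: "\<lbrakk>a \<in> carrier S; b \<in> carrier S; c \<in> carrier S\<rbrakk>
          \<Longrightarrow> (a \<cdot> b) \<cdot> c = a \<cdot> (b \<cdot> c)"
    and zero_closed: "\<o> \<in> carrier S"
    and zero_mult: "a \<in> carrier S \<Longrightarrow> \<o> \<cdot> a = \<o>"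
    and mult_zero: "a \<in> carrier S \<Longrightarrow> a \<cdot> \<o> = \<o>"
    and ex1_inverse: "a \<in> carrier S \<Longrightarrow> \<exists>!b. b \<in> carrier S \<and> a \<cdot> b \<cdot> a = a \<and> b \<cdot> a \<cdot> b = b"

definition sinv :: "('a, 'm) zsemigroup_scheme \<Rightarrow> 'a \<Rightarrow> 'a" where
  "sinv S a = (THE b. b \<in> carrier S \<and> a \<cdot>\<^bsub>S\<^esub> b \<cdot>\<^bsub>S\<^esub> a = a \<and> b \<cdot>\<^bsub>S\<^esub> a \<cdot>\<^bsub>S\<^esub> b = b)"

definition idems :: "('a, 'm) zsemigroup_scheme \<Rightarrow> 'a set" where
  "idems S = {e \<in> carrier S. e \<cdot>\<^bsub>S\<^esub> e = e}"

definition nat_le :: "('a, 'm) zsemigroup_scheme \<Rightarrow> 'a \<Rightarrow> 'a \<Rightarrow> bool" where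
  "nat_le S a b \<longleftrightarrow> a \<in> carrier S \<and> b \<in> carrier S \<and> (\<exists>e \<in> idems S. a = e \<cdot>\<^bsub>S\<^esub> b)"

definition down :: "('a, 'm) zsemigroup_scheme \<Rightarrow> 'a \<Rightarrow> 'a set" where
  "down S a = {y. nat_le S y a}"

definition set_prod :: "('a, 'm) zsemigroup_scheme \<Rightarrow> 'a set \<Rightarrow> 'a set \<Rightarrow> 'a set" where
  "set_prod S X Y = {x \<cdot>\<^bsub>S\<^esub> y | x y. x \<in> X \<and> y \<in> Y}"

definition compatible :: "('a, 'm) zsemigroup_scheme \<Rightarrow> 'a \<Rightarrow> 'a \<Rightarrow> bool" where
  "compatible S s t \<longleftrightarrow> sinv S s \<cdot>\<^bsub>S\<^esub> t \<in> idems S \<and> s \<cdot>\<^bsub>S\<^esub> sinv S t \<in> idems S"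

definition compatible_set :: "('a, 'm) zsemigroup_scheme \<Rightarrow> 'a set \<Rightarrow> bool" where
  "compatible_set S X \<longleftrightarrow> X \<subseteq> carrier S \<and> (\<forall>x \<in> X. \<forall>y \<in> X. compatible S x y)"

definition is_join :: "('a, 'm) zsemigroup_scheme \<Rightarrow> 'a set \<Rightarrow> 'a \<Rightarrow> bool" where
  "is_join S X j \<longleftrightarrow> j \<in> carrier S \<and> (\<forall>x \<in> X. nat_le S x j)
     \<and> (\<forall>u \<in> carrier S. (\<forall>x \<in> X. nat_le S x u) \<longrightarrow> nat_le S j u)"

definition semigroup_hom ::
  "('a, 'm) zsemigroup_scheme \<Rightarrow> ('b, 'n) zsemigroup_scheme \<Rightarrow> ('a \<Rightarrow> 'b) \<Rightarrow> bool" where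
  "semigroup_hom S T f \<longleftrightarrow> f \<in> carrier S \<rightarrow> carrier T
     \<and> (\<forall>a \<in> carrier S. \<forall>b \<in> carrier S. f (a \<cdot>\<^bsub>S\<^esub> b) = f a \<cdot>\<^bsub>T\<^esub> f b)
     \<and> f \<o>\<^bsub>S\<^esub> = \<o>\<^bsub>T\<^esub>"


section \<open>Pseudogroups\<close>

locale pseudogroup = inverse_semigroup +
  assumes ex_unit: "\<exists>u \<in> carrier S. \<forall>a \<in> carrier S. u \<cdot> a = a \<and> a \<cdot> u = a"
    and ex_join: "compatible_set S X \<Longrightarrow> \<exists>j. is_join S X j"
    and mult_join_left: "\<lbrakk>compatible_set S X; is_join S X j; s \<in> carrier S\<rbrakk>
          \<Longrightarrow> is_join S ((\<lambda>x. s \<cdot> x) ` X) (s \<cdot> j)"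
    and mult_join_right: "\<lbrakk>compatible_set S X; is_join S X j; s \<in> carrier S\<rbrakk>
          \<Longrightarrow> is_join S ((\<lambda>x. x \<cdot> s) ` X) (j \<cdot> s)"

text \<open>Pseudogroup morphisms are not required to preserve the monoid identity.\<close>

definition pseudogroup_morphism ::
  "('a, 'm) zsemigroup_scheme \<Rightarrow> ('b, 'n) zsemigroup_scheme \<Rightarrow> ('a \<Rightarrow> 'b) \<Rightarrow> bool" where
  "pseudogroup_morphism P Q f \<longleftrightarrow> pseudogroup P \<and> pseudogroup Q \<and> semigroup_hom P Q f
     \<and> (\<forall>X j. compatible_set P X \<and> is_join P X j \<longrightarrow> is_join Q (f ` X) (f j))"

definition nucleus :: "('a, 'm) zsemigroup_scheme \<Rightarrow> ('a \<Rightarrow> 'a) \<Rightarrow> bool" where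
  "nucleus P \<nu> \<longleftrightarrow> inverse_semigroup P \<and> \<nu> \<in> carrier P \<rightarrow> carrier P
     \<and> (\<forall>a \<in> carrier P. nat_le P a (\<nu> a))
     \<and> (\<forall>a \<in> carrier P. \<forall>b \<in> carrier P. nat_le P a b \<longrightarrow> nat_le P (\<nu> a) (\<nu> b))
     \<and> (\<forall>a \<in> carrier P. \<nu> (\<nu> a) = \<nu> a)
     \<and> (\<forall>a \<in> carrier P. \<forall>b \<in> carrier P. nat_le P (\<nu> a \<cdot>\<^bsub>P\<^esub> \<nu> b) (\<nu> (a \<cdot>\<^bsub>P\<^esub> b)))"


section \<open>Coverages\<close>

text \<open>A coverage is a function \<open>\<C>\<close> on the underlying type; its values outside the
  carrier are irrelevant. The empty set is allowed as a member of \<open>\<C> a\<close>.\<close>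

locale coverage = inverse_semigroup S
  for S :: "('a, 'm) zsemigroup_scheme" (structure) +
  fixes \<C> :: "'a \<Rightarrow> 'a set set"
  assumes cover_below: "\<lbrakk>a \<in> carrier S; X \<in> \<C> a\<rbrakk> \<Longrightarrow> X \<subseteq> down S a"
    and R: "a \<in> carrier S \<Longrightarrow> {a} \<in> \<C> a"
    and I: "\<lbrakk>a \<in> carrier S; X \<in> \<C> a\<rbrakk> \<Longrightarrow> sinv S ` X \<in> \<C> (sinv S a)"
    and MS: "\<lbrakk>a \<in> carrier S; b \<in> carrier S; X \<in> \<C> a; Y \<in> \<C> b\<rbrakk>
          \<Longrightarrow> set_prod S X Y \<in> \<C> (a \<cdot> b)"
    and T: "\<lbrakk>a \<in> carrier S; X \<in> \<C> a; \<And>x. x \<in> X \<Longrightarrow> F x \<in> \<C> x\<rbrakk>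
          \<Longrightarrow> (\<Union>x \<in> X. F x) \<in> \<C> a"

locale idempotent_pure_coverage = coverage +
  assumes idempotent_pure: "\<lbrakk>a \<in> carrier S; X \<in> \<C> a; X \<subseteq> idems S\<rbrakk> \<Longrightarrow> a \<in> idems S"

definition cover_to_join_map ::
  "('a, 'm) zsemigroup_scheme \<Rightarrow> ('a \<Rightarrow> 'a set set) \<Rightarrow> ('b, 'n) zsemigroup_scheme
     \<Rightarrow> ('a \<Rightarrow> 'b) \<Rightarrow> bool" where
  "cover_to_join_map S \<C> T \<theta> \<longleftrightarrow> pseudogroup T \<and> semigroup_hom S T \<theta>
     \<and> (\<forall>a \<in> carrier S. \<forall>X \<in> \<C> a. is_join T (\<theta> ` X) (\<theta> a))"


section \<open>The pseudogroups of compatible order ideals and of closed ones\<close>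

definition order_ideal :: "('a, 'm) zsemigroup_scheme \<Rightarrow> 'a set \<Rightarrow> bool" where
  "order_ideal S A \<longleftrightarrow> A \<subseteq> carrier S \<and> \<o>\<^bsub>S\<^esub> \<in> A \<and> (\<forall>a \<in> A. down S a \<subseteq> A)"

definition ideal_pseudogroup :: "('a, 'm) zsemigroup_scheme \<Rightarrow> 'a set zsemigroup" where
  "ideal_pseudogroup S =
     \<lparr>carrier = {A. order_ideal S A \<and> compatible_set S A},
      smult = set_prod S,
      szero = {\<o>\<^bsub>S\<^esub>}\<rparr>"

definition cov_closure ::
  "('a, 'm) zsemigroup_scheme \<Rightarrow> ('a \<Rightarrow> 'a set set) \<Rightarrow> 'a set \<Rightarrow> 'a set" where
  "cov_closure S \<C> A = {x \<in> carrier S. \<exists>X. X \<subseteq> A \<and> X \<in> \<C> x}"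

definition cov_closed ::
  "('a, 'm) zsemigroup_scheme \<Rightarrow> ('a \<Rightarrow> 'a set set) \<Rightarrow> 'a set \<Rightarrow> bool" where
  "cov_closed S \<C> A \<longleftrightarrow> A \<subseteq> carrier S \<and> (\<forall>x \<in> carrier S. \<forall>X \<in> \<C> x. X \<subseteq> A \<longrightarrow> x \<in> A)"

text \<open>The zero is the closure of \<open>{\<o>}\<close>, which is larger than \<open>{\<o>}\<close> when some nonzero
  element is covered by \<open>{}\<close> or \<open>{\<o>}\<close>.\<close>

definition closed_ideal_pseudogroup ::
  "('a, 'm) zsemigroup_scheme \<Rightarrow> ('a \<Rightarrow> 'a set set) \<Rightarrow> 'a set zsemigroup" where
  "closed_ideal_pseudogroup S \<C> =
     \<lparr>carrier = {A \<in> carrier (ideal_pseudogroup S). cov_closed S \<C> A},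
      smult = (\<lambda>A B. cov_closure S \<C> (set_prod S A B)),
      szero = cov_closure S \<C> {\<o>\<^bsub>S\<^esub>}\<rparr>"

definition cov_iota ::
  "('a, 'm) zsemigroup_scheme \<Rightarrow> ('a \<Rightarrow> 'a set set) \<Rightarrow> 'a \<Rightarrow> 'a set" where
  "cov_iota S \<C> s = cov_closure S \<C> (down S s)"

end

theory Submission
  imports Defs
begin

text \<open>Axioms (I) and (MS) together with idempotent-purity show that the closure of a compatible
  order ideal is again compatible; this makes the closed compatible order ideals an inverse
  semigroup, with inverse \<open>A \<mapsto> A\<inverse>\<close>, natural order \<open>\<subseteq>\<close>, and the closed order ideals of
  \<open>E(S)\<close> as idempotents. The join of a compatible family is the closure of its union.
  The pseudogroup \<open>C(S)\<close> is the special case of the coverage whose only cover of \<open>a\<close> is \<open>{a}\<close>,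
  for which every subset is closed. Every closed \<open>A\<close> is the join of the \<open>\<iota>(a)\<close>, \<open>a \<in> A\<close>, so a morphism
  extending \<open>\<theta>\<close> must send \<open>A\<close> to the join of \<open>\<theta>(A)\<close>. This works because \<open>\<theta>(A)\<close> and
  \<open>\<theta>(cl A)\<close> have the same upper bounds.\<close>

section \<open>Inverse semigroups\<close>

text \<open>The delicate point is that idempotents of \<open>CSC\<close> commute, since uniqueness
  of inverses rests on it. For closed ideals the equation \<open>cl (set_prod S A A) = A\<close>
  says nothing about single elements at first sight. It does give A A \<subseteq> A, however, so for
  y and w in A the product y w lies in A and is compatible with both y and w. In any inverse
  semigroup this forces y w to be idempotent (\<open>idem_if_product_compatible\<close>), and purity
  passes from A A to its closure A. Inverses exist because a^-1 b is idempotent for a, b in a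
  compatible set: this collapses A A^-1 A to A, and more generally A A^-1 B to A when A lies in B,
  which also identifies the natural order with inclusion. Products carry a closure in every step;
  (MS) allows all inner closures to be dropped, so that identities need only be checked for subset
  products. The trivial coverage yields the carrier and zero of \<open>ideal_pseudogroup S\<close>,
  but the same product only on that carrier, hence the transport lemmas for structures that agree
  there.\<close>

context inverse_semigroup
begin

lemma sinv_props:
  assumes "a \<in> carrier S"
  shows "sinv S a \<in> carrier S" "a \<cdot> sinv S a \<cdot> a = a" "sinv S a \<cdot> a \<cdot> sinv S a = sinv S a"
  using theI'[OF ex1_inverse[OF assms]] unfolding sinv_def by auto

lemmas sinv_closed = sinv_props(1)

lemma sinv_unique:
  assumes "a \<in> carrier S" "b \<in> carrier S" "a \<cdot> b \<cdot> a = a" "b \<cdot> a \<cdot> b = b"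
  shows "sinv S a = b"
  unfolding sinv_def by (rule the1_equality[OF ex1_inverse]) (use assms in auto)

lemma sinv_sinv: "a \<in> carrier S \<Longrightarrow> sinv S (sinv S a) = a"
  by (rule sinv_unique) (auto simp: sinv_props)

lemma idems_closed: "e \<in> idems S \<Longrightarrow> e \<in> carrier S"
  by (simp add: idems_def)

lemma idems_idem: "e \<in> idems S \<Longrightarrow> e \<cdot> e = e"
  by (simp add: idems_def)

lemma sinv_idem: "e \<in> idems S \<Longrightarrow> sinv S e = e"
  by (rule sinv_unique) (auto simp: idems_def)

lemma mult_sinv_assoc:
  assumes "a \<in> carrier S" "b \<in> carrier S"
  shows "a \<cdot> (sinv S a \<cdot> (a \<cdot> b)) = a \<cdot> b" "sinv S a \<cdot> (a \<cdot> (sinv S a \<cdot> b)) = sinv S a \<cdot> b"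
    "a \<cdot> (sinv S a \<cdot> a) = a" "sinv S a \<cdot> (a \<cdot> sinv S a) = sinv S a"
proof -
  have c: "sinv S a \<in> carrier S" using assms sinv_closed by auto
  show "a \<cdot> (sinv S a \<cdot> (a \<cdot> b)) = a \<cdot> b"
    using sinv_props(2)[OF assms(1)] assms c by (metis mult_assoc mult_closed)
  show "sinv S a \<cdot> (a \<cdot> (sinv S a \<cdot> b)) = sinv S a \<cdot> b"
    using sinv_props(3)[OF assms(1)] assms c by (metis mult_assoc mult_closed)
  show "a \<cdot> (sinv S a \<cdot> a) = a" "sinv S a \<cdot> (a \<cdot> sinv S a) = sinv S a"
    using sinv_props[OF assms(1)] assms c by (auto simp: mult_assoc)
qed

lemma idem_assoc: "e \<in> idems S \<Longrightarrow> b \<in> carrier S \<Longrightarrow> e \<cdot> (e \<cdot> b) = e \<cdot> b"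
  by (metis idems_closed idems_idem mult_assoc)

text \<open>Let x be the inverse of e f. Then f x e is an inverse of e f too, so x = f x e by
  uniqueness, and this form shows x x = x. An idempotent is its own inverse, hence e f = x.\<close>

lemma idems_mult:
  assumes "e \<in> idems S" "f \<in> idems S"
  shows "e \<cdot> f \<in> idems S"
proof -
  note ef = idems_closed[OF assms(1)] idems_closed[OF assms(2)]
  have efc: "e \<cdot> f \<in> carrier S" using ef mult_closed by auto
  define x where "x = sinv S (e \<cdot> f)"
  have x: "x \<in> carrier S" "(e \<cdot> f) \<cdot> x \<cdot> (e \<cdot> f) = e \<cdot> f" "x \<cdot> (e \<cdot> f) \<cdot> x = x"
    unfolding x_def using sinv_props[OF efc] by auto
  have x2: "e \<cdot> (f \<cdot> (x \<cdot> (e \<cdot> f))) = e \<cdot> f" "x \<cdot> (e \<cdot> (f \<cdot> x)) = x"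
    using x ef by (auto simp: mult_assoc mult_closed)
  have x3: "x \<cdot> (e \<cdot> (f \<cdot> (x \<cdot> y))) = x \<cdot> y" if "y \<in> carrier S" for y
    using x2(2) x(1) ef that by (metis mult_assoc mult_closed)
  have x_fxe: "x = f \<cdot> x \<cdot> e"
    unfolding x_def
    by (rule sinv_unique)
      (use assms ef x x2 x3 in \<open>auto simp: mult_assoc mult_closed idem_assoc x_def[symmetric]\<close>)
  have xx: "x \<cdot> x = x"
  proof -
    have "x \<cdot> x = (f \<cdot> x \<cdot> e) \<cdot> (f \<cdot> x \<cdot> e)" using x_fxe by simp
    also have "\<dots> = f \<cdot> x \<cdot> e"
      using ef x(1) x3 by (simp add: mult_assoc mult_closed)
    finally show ?thesis using x_fxe by simp
  qed
  have "sinv S x = x" by (rule sinv_idem) (use x xx in \<open>simp add: idems_def\<close>)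
  moreover have "sinv S x = e \<cdot> f" unfolding x_def using efc by (rule sinv_sinv)
  ultimately show ?thesis using xx x(1) by (simp add: idems_def)
qed

text \<open>As e f and f e are both idempotent, f e satisfies the equations for an inverse of e f;
  but e f is its own inverse.\<close>

lemma idems_commute:
  assumes "e \<in> idems S" "f \<in> idems S"
  shows "e \<cdot> f = f \<cdot> e"
proof -
  note ef = idems_closed[OF assms(1)] idems_closed[OF assms(2)]
  have 1: "e \<cdot> f \<in> idems S" "f \<cdot> e \<in> idems S" using assms idems_mult by auto
  have "sinv S (e \<cdot> f) = f \<cdot> e"
    by (rule sinv_unique)
      (use 1[THEN idems_idem] 1[THEN idems_closed] assms ef in
        \<open>auto simp: mult_assoc mult_closed idem_assoc\<close>)
  then show ?thesis using sinv_idem[OF 1(1)] by simp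
qed

lemma sinv_mult_idems:
  assumes "a \<in> carrier S"
  shows "sinv S a \<cdot> a \<in> idems S" "a \<cdot> sinv S a \<in> idems S"
  using assms by (auto simp: idems_def mult_assoc mult_closed sinv_closed mult_sinv_assoc)

text \<open>The inner factors a^-1 a and b b^-1 are idempotents; commuting them lets each be
  absorbed by its neighbours.\<close>

lemma sinv_mult:
  assumes ab: "a \<in> carrier S" "b \<in> carrier S"
  shows "sinv S (a \<cdot> b) = sinv S b \<cdot> sinv S a"
proof (rule sinv_unique)
  define e where "e = sinv S a \<cdot> a"
  define f where "f = b \<cdot> sinv S b"
  have ef: "e \<in> idems S" "f \<in> idems S" "e \<cdot> f = f \<cdot> e"
    using sinv_mult_idems idems_commute ab by (auto simp: e_def f_def)
  note ac = mult_assoc mult_closed sinv_closed mult_sinv_assoc idems_closed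
  have "a \<cdot> b \<cdot> (sinv S b \<cdot> sinv S a) \<cdot> (a \<cdot> b) = a \<cdot> (f \<cdot> e) \<cdot> b"
    using ab by (simp add: ac e_def f_def)
  also have "\<dots> = a \<cdot> (e \<cdot> f) \<cdot> b" by (simp add: ef(3))
  also have "\<dots> = a \<cdot> b" using ab by (simp add: ac e_def f_def)
  finally show "a \<cdot> b \<cdot> (sinv S b \<cdot> sinv S a) \<cdot> (a \<cdot> b) = a \<cdot> b" .
  have "sinv S b \<cdot> sinv S a \<cdot> (a \<cdot> b) \<cdot> (sinv S b \<cdot> sinv S a) = sinv S b \<cdot> (e \<cdot> f) \<cdot> sinv S a"
    using ab by (simp add: ac e_def f_def)
  also have "\<dots> = sinv S b \<cdot> (f \<cdot> e) \<cdot> sinv S a" by (simp add: ef(3))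
  also have "\<dots> = sinv S b \<cdot> sinv S a" using ab by (simp add: ac e_def f_def)
  finally show "sinv S b \<cdot> sinv S a \<cdot> (a \<cdot> b) \<cdot> (sinv S b \<cdot> sinv S a) = sinv S b \<cdot> sinv S a" .
qed (use ab in \<open>auto simp: mult_closed sinv_closed\<close>)

lemma conj_idem:
  assumes "e \<in> idems S" "b \<in> carrier S"
  shows "sinv S b \<cdot> e \<cdot> b \<in> idems S"
proof -
  have e: "e \<in> carrier S" using assms idems_closed by auto
  note ac = mult_assoc mult_closed sinv_closed mult_sinv_assoc idem_assoc
  have "(sinv S b \<cdot> e \<cdot> b) \<cdot> (sinv S b \<cdot> e \<cdot> b) = sinv S b \<cdot> (e \<cdot> (b \<cdot> sinv S b)) \<cdot> (e \<cdot> b)"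
    using assms e by (simp add: ac)
  also have "e \<cdot> (b \<cdot> sinv S b) = (b \<cdot> sinv S b) \<cdot> e"
    using assms idems_commute sinv_mult_idems by blast
  also have "sinv S b \<cdot> ((b \<cdot> sinv S b) \<cdot> e) \<cdot> (e \<cdot> b) = sinv S b \<cdot> e \<cdot> b"
    using assms e by (simp add: ac)
  finally show ?thesis using assms e by (simp add: idems_def ac)
qed

text \<open>An idempotent can be pushed through b at the cost of a conjugation, because it commutes
  with b b^-1.\<close>

lemma idem_mult_swap:
  assumes "e \<in> idems S" "b \<in> carrier S"
  shows "e \<cdot> b = b \<cdot> (sinv S b \<cdot> e \<cdot> b)"
proof -
  have e: "e \<in> carrier S" using assms idems_closed by auto
  note ac = mult_assoc mult_closed sinv_closed mult_sinv_assoc idem_assoc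
  have "b \<cdot> (sinv S b \<cdot> e \<cdot> b) = ((b \<cdot> sinv S b) \<cdot> e) \<cdot> b" using assms e by (simp add: ac)
  also have "(b \<cdot> sinv S b) \<cdot> e = e \<cdot> (b \<cdot> sinv S b)"
    using assms idems_commute sinv_mult_idems by blast
  also have "(e \<cdot> (b \<cdot> sinv S b)) \<cdot> b = e \<cdot> b" using assms e by (simp add: ac)
  finally show ?thesis by simp
qed

lemma conj_idem':
  "e \<in> idems S \<Longrightarrow> b \<in> carrier S \<Longrightarrow> b \<cdot> e \<cdot> sinv S b \<in> idems S"
  using conj_idem[of e "sinv S b"] by (simp add: sinv_closed sinv_sinv)

lemma mult_idem_swap:
  assumes "e \<in> idems S" "b \<in> carrier S"
  shows "b \<cdot> e = (b \<cdot> e \<cdot> sinv S b) \<cdot> b"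
proof -
  have e: "e \<in> carrier S" using assms idems_closed by auto
  note ac = mult_assoc mult_closed sinv_closed mult_sinv_assoc idem_assoc
  have "(b \<cdot> e \<cdot> sinv S b) \<cdot> b = b \<cdot> (e \<cdot> (sinv S b \<cdot> b))" using assms e by (simp add: ac)
  also have "e \<cdot> (sinv S b \<cdot> b) = (sinv S b \<cdot> b) \<cdot> e"
    using assms idems_commute sinv_mult_idems by blast
  also have "b \<cdot> ((sinv S b \<cdot> b) \<cdot> e) = b \<cdot> e" using assms e by (simp add: ac)
  finally show ?thesis by simp
qed

section \<open>The natural partial order\<close>

lemma nat_le_closed: "nat_le S a b \<Longrightarrow> a \<in> carrier S" "nat_le S a b \<Longrightarrow> b \<in> carrier S"
  by (auto simp: nat_le_def)

lemma nat_le_idem_mult: "e \<in> idems S \<Longrightarrow> b \<in> carrier S \<Longrightarrow> nat_le S (e \<cdot> b) b"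
  unfolding nat_le_def using idems_closed mult_closed by blast

text \<open>The order is defined by idempotents acting on the left; conjugation turns b e into (b e
  b^-1) b and so makes it left-right symmetric.\<close>

lemma nat_le_mult_idem: "e \<in> idems S \<Longrightarrow> b \<in> carrier S \<Longrightarrow> nat_le S (b \<cdot> e) b"
  using nat_le_idem_mult[OF conj_idem', of e b b] mult_idem_swap[of e b] by simp

lemma nat_le_refl: "a \<in> carrier S \<Longrightarrow> nat_le S a a"
  using nat_le_idem_mult[OF sinv_mult_idems(2), of a a] by (simp add: sinv_props)

lemma nat_le_trans: "nat_le S a b \<Longrightarrow> nat_le S b c \<Longrightarrow> nat_le S a c"
  unfolding nat_le_def using idems_mult idems_closed mult_assoc by metis

lemma nat_le_antisym:
  assumes "nat_le S a b" "nat_le S b a"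
  shows "a = b"
proof -
  obtain e f where ef: "e \<in> idems S" "f \<in> idems S" "a = e \<cdot> b" "b = f \<cdot> a"
    using assms unfolding nat_le_def by auto
  have c: "a \<in> carrier S" "b \<in> carrier S" "e \<in> carrier S" "f \<in> carrier S"
    using assms[THEN nat_le_closed(1)] ef(1,2)[THEN idems_closed] by auto
  \<comment> \<open>Since a = e b, the idempotent e fixes a; commuting e with f then turns e f a
    into f a, which is b.\<close>
  have "a = e \<cdot> (f \<cdot> a)" by (subst ef(4)[symmetric]) (rule ef(3))
  also have "\<dots> = (e \<cdot> f) \<cdot> a" using c by (simp add: mult_assoc)
  also have "\<dots> = (f \<cdot> e) \<cdot> a" using idems_commute[OF ef(1,2)] by simp
  also have "\<dots> = f \<cdot> (e \<cdot> (e \<cdot> b))" using c by (subst ef(3)) (simp add: mult_assoc mult_closed)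
  also have "\<dots> = f \<cdot> a" using idem_assoc[OF ef(1) c(2)] ef(3)[symmetric] by simp
  finally show ?thesis using ef(4) by simp
qed

lemma nat_le_mult:
  assumes "nat_le S a b" "nat_le S c d"
  shows "nat_le S (a \<cdot> c) (b \<cdot> d)"
proof -
  obtain e f where ef: "e \<in> idems S" "f \<in> idems S" "a = e \<cdot> b" "c = f \<cdot> d"
    using assms unfolding nat_le_def by auto
  have c: "b \<in> carrier S" "d \<in> carrier S" "e \<in> carrier S" "f \<in> carrier S"
    using assms nat_le_closed ef idems_closed by auto
  have "a \<cdot> c = e \<cdot> (b \<cdot> f) \<cdot> d" using c ef by (simp add: mult_assoc mult_closed)
  also have "\<dots> = e \<cdot> ((b \<cdot> f \<cdot> sinv S b) \<cdot> b) \<cdot> d"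
    using mult_idem_swap[OF ef(2) c(1)] by simp
  also have "\<dots> = (e \<cdot> (b \<cdot> f \<cdot> sinv S b)) \<cdot> (b \<cdot> d)"
    using c by (simp add: mult_assoc mult_closed sinv_closed)
  finally show ?thesis
    using nat_le_idem_mult[OF idems_mult[OF ef(1) conj_idem'[OF ef(2) c(1)]]] c mult_closed by simp
qed

lemma nat_le_sinv:
  assumes "nat_le S a b" shows "nat_le S (sinv S a) (sinv S b)"
proof -
  obtain e where e: "e \<in> idems S" "a = e \<cdot> b" "b \<in> carrier S"
    using assms unfolding nat_le_def by auto
  then have "sinv S a = sinv S b \<cdot> e" by (simp add: sinv_mult idems_closed sinv_idem)
  then show ?thesis using nat_le_mult_idem e sinv_closed by simp
qed

lemma nat_le_idem: "nat_le S a e \<Longrightarrow> e \<in> idems S \<Longrightarrow> a \<in> idems S"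
  unfolding nat_le_def using idems_mult by blast

lemma zero_idem: "\<o> \<in> idems S"
  using zero_closed zero_mult by (simp add: idems_def)

lemma zero_nat_le: "a \<in> carrier S \<Longrightarrow> nat_le S \<o> a"
  using nat_le_idem_mult[OF zero_idem, of a] zero_mult by simp

text \<open>With z = y w, compatibility yields z \<le> y and z \<le> w, hence z z^-1 y = z and w
  z^-1 z = z. The first gives z = z z^-1 y w = z w, and then z z = z w z^-1 z = z z^-1 z =
  z.\<close>

lemma idem_if_product_compatible:
  assumes yw: "y \<in> carrier S" "w \<in> carrier S"
    and "compatible S y (y \<cdot> w)" "compatible S (y \<cdot> w) w"
  shows "y \<cdot> w \<in> idems S"
proof -
  define z where "z = y \<cdot> w"
  have z: "z \<in> carrier S" using yw mult_closed z_def by simp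
  have e: "sinv S y \<cdot> z \<in> idems S" and f: "z \<cdot> sinv S w \<in> idems S"
    using assms(3,4) by (auto simp: compatible_def z_def)
  note ac = mult_assoc mult_closed sinv_closed mult_sinv_assoc
  have "y \<cdot> (sinv S y \<cdot> z) = z" "(z \<cdot> sinv S w) \<cdot> w = z"
    using yw by (simp_all add: z_def ac)
  then have le: "nat_le S z y" "nat_le S z w"
    using nat_le_mult_idem[OF e yw(1)] nat_le_idem_mult[OF f yw(2)] by auto
  have zy: "z \<cdot> sinv S z \<cdot> y = z"
  proof -
    obtain g where g: "g \<in> idems S" "z = g \<cdot> y" using le unfolding nat_le_def by auto
    have "z \<cdot> sinv S z \<cdot> y = g \<cdot> ((y \<cdot> sinv S y) \<cdot> g) \<cdot> y"
      using g yw by (simp add: ac idems_closed sinv_mult sinv_idem)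
    also have "\<dots> = g \<cdot> (g \<cdot> (y \<cdot> sinv S y)) \<cdot> y"
      using idems_commute[OF g(1) sinv_mult_idems(2)[OF yw(1)]] by simp
    also have "\<dots> = z" using g yw by (simp add: ac idems_closed idem_assoc)
    finally show ?thesis .
  qed
  have wz: "w \<cdot> sinv S z \<cdot> z = z"
  proof -
    obtain g where g: "g \<in> idems S" "z = g \<cdot> w" using le unfolding nat_le_def by auto
    have "w \<cdot> sinv S z \<cdot> z = (w \<cdot> sinv S w) \<cdot> g \<cdot> w"
      using g yw by (simp add: ac idems_closed sinv_mult sinv_idem idem_assoc)
    also have "\<dots> = g \<cdot> (w \<cdot> sinv S w) \<cdot> w"
      using g yw idems_commute[OF g(1) sinv_mult_idems(2)[OF yw(2)]]
      by simp
    also have "\<dots> = z" using g yw by (simp add: ac idems_closed)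
    finally show ?thesis .
  qed
  have "z = z \<cdot> sinv S z \<cdot> y \<cdot> w" using z yw by (simp add: ac z_def[symmetric])
  then have zw: "z = z \<cdot> w" using zy by simp
  have "z \<cdot> z = z \<cdot> (w \<cdot> sinv S z \<cdot> z)" using wz by simp
  also have "\<dots> = (z \<cdot> w) \<cdot> (sinv S z \<cdot> z)" using z yw by (simp add: ac)
  also have "\<dots> = z" using zw z by (simp add: ac)
  finally show ?thesis using z by (simp add: idems_def z_def)
qed

lemma is_join_unique: "is_join S X j \<Longrightarrow> is_join S X k \<Longrightarrow> j = k"
  unfolding is_join_def using nat_le_antisym by blast

section \<open>Subset products, order ideals and compatible sets\<close>

lemma set_prod_closed: "A \<subseteq> carrier S \<Longrightarrow> B \<subseteq> carrier S \<Longrightarrow> set_prod S A B \<subseteq> carrier S"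
  unfolding set_prod_def using mult_closed by blast

lemma set_prodI: "a \<in> A \<Longrightarrow> b \<in> B \<Longrightarrow> a \<cdot> b \<in> set_prod S A B"
  unfolding set_prod_def by blast

lemma set_prod_mono: "A \<subseteq> A' \<Longrightarrow> B \<subseteq> B' \<Longrightarrow> set_prod S A B \<subseteq> set_prod S A' B'"
  unfolding set_prod_def by blast

lemma set_prod_assoc:
  assumes "A \<subseteq> carrier S" "B \<subseteq> carrier S" "C \<subseteq> carrier S"
  shows "set_prod S (set_prod S A B) C = set_prod S A (set_prod S B C)"
proof -
  have assoc: "(a \<cdot> b) \<cdot> c = a \<cdot> (b \<cdot> c)" if "a \<in> A" "b \<in> B" "c \<in> C" for a b c
    using that assms mult_assoc by blast
  have "set_prod S (set_prod S A B) C = {(a \<cdot> b) \<cdot> c | a b c. a \<in> A \<and> b \<in> B \<and> c \<in> C}"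
    unfolding set_prod_def by blast
  also have "\<dots> = {a \<cdot> (b \<cdot> c) | a b c. a \<in> A \<and> b \<in> B \<and> c \<in> C}"
    using assoc by (intro Collect_cong) metis
  also have "\<dots> = set_prod S A (set_prod S B C)"
    unfolding set_prod_def by blast
  finally show ?thesis .
qed

lemma order_idealD: "order_ideal S A \<Longrightarrow> a \<in> A \<Longrightarrow> nat_le S b a \<Longrightarrow> b \<in> A"
  unfolding order_ideal_def down_def by blast

lemma order_ideal_set_prod:
  assumes "order_ideal S A" "order_ideal S B"
  shows "order_ideal S (set_prod S A B)"
proof -
  have c: "A \<subseteq> carrier S" "B \<subseteq> carrier S" using assms by (auto simp: order_ideal_def)
  have "\<o> \<in> set_prod S A B"
    using set_prodI[of "\<o>" A "\<o>" B] assms zero_mult zero_closed by (simp add: order_ideal_def)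
  moreover have "y \<in> set_prod S A B" if ab: "a \<in> A" "b \<in> B" and y: "nat_le S y (a \<cdot> b)" for a b y
  proof -
    \<comment> \<open>The idempotent witnessing y \<le> a b is absorbed into the left factor, where
      A is downward closed.\<close>
    obtain e where e: "e \<in> idems S" "y = e \<cdot> (a \<cdot> b)" using y unfolding nat_le_def by auto
    have "y = (e \<cdot> a) \<cdot> b" using e ab c idems_closed by (auto simp: mult_assoc subset_iff)
    moreover have "e \<cdot> a \<in> A"
      using order_idealD[OF assms(1) ab(1)] nat_le_idem_mult e ab c by blast
    ultimately show ?thesis using set_prodI ab by simp
  qed
  ultimately show ?thesis using set_prod_closed[OF c]
    unfolding order_ideal_def down_def set_prod_def by blast
qed

lemma compatible_setI:
  assumes "A \<subseteq> carrier S"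
    and "\<And>x y. x \<in> A \<Longrightarrow> y \<in> A \<Longrightarrow> sinv S x \<cdot> y \<in> idems S"
    and "\<And>x y. x \<in> A \<Longrightarrow> y \<in> A \<Longrightarrow> x \<cdot> sinv S y \<in> idems S"
  shows "compatible_set S A"
  using assms unfolding compatible_set_def compatible_def by blast

lemma compatible_setD:
  assumes "compatible_set S A" "x \<in> A" "y \<in> A"
  shows "sinv S x \<cdot> y \<in> idems S" "x \<cdot> sinv S y \<in> idems S" "x \<in> carrier S"
  using assms unfolding compatible_set_def compatible_def by blast+

text \<open>Pushing e to the right through y leaves x y times an idempotent. In a product of
  compatible sets, the middle factor a^-1 a' or b b'^-1 plays the role of e.\<close>

lemma mult_idem_conj:
  assumes "e \<in> idems S" "x \<in> carrier S" "y \<in> carrier S" "x \<cdot> y \<in> idems S"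
  shows "x \<cdot> e \<cdot> y \<in> idems S"
proof -
  have "x \<cdot> e \<cdot> y = x \<cdot> (y \<cdot> (sinv S y \<cdot> e \<cdot> y))"
    using assms idem_mult_swap[of e y] by (simp add: mult_assoc mult_closed idems_closed)
  also have "\<dots> = (x \<cdot> y) \<cdot> (sinv S y \<cdot> e \<cdot> y)"
    using assms by (simp add: mult_assoc mult_closed sinv_closed idems_closed)
  finally show ?thesis using idems_mult[OF assms(4) conj_idem[OF assms(1,3)]] by simp
qed

lemma compatible_set_set_prod:
  assumes "compatible_set S A" "compatible_set S B"
  shows "compatible_set S (set_prod S A B)"
proof -
  note ac = mult_assoc mult_closed sinv_closed sinv_mult
  have c: "A \<subseteq> carrier S" "B \<subseteq> carrier S" using assms by (auto simp: compatible_set_def)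
  have "sinv S (a \<cdot> b) \<cdot> (a' \<cdot> b') \<in> idems S" "(a \<cdot> b) \<cdot> sinv S (a' \<cdot> b') \<in> idems S"
    if ab: "a \<in> A" "b \<in> B" "a' \<in> A" "b' \<in> B" for a b a' b'
  proof -
    have cc: "a \<in> carrier S" "b \<in> carrier S" "a' \<in> carrier S" "b' \<in> carrier S" using c ab by auto
    have "sinv S (a \<cdot> b) \<cdot> (a' \<cdot> b') = sinv S b \<cdot> (sinv S a \<cdot> a') \<cdot> b'"
      using cc by (simp add: ac)
    also have "\<dots> \<in> idems S"
      by (rule mult_idem_conj) (use cc assms ab in \<open>auto simp: sinv_closed compatible_setD\<close>)
    finally show "sinv S (a \<cdot> b) \<cdot> (a' \<cdot> b') \<in> idems S" .
    have "(a \<cdot> b) \<cdot> sinv S (a' \<cdot> b') = a \<cdot> (b \<cdot> sinv S b') \<cdot> sinv S a'"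
      using cc by (simp add: ac)
    also have "\<dots> \<in> idems S"
      by (rule mult_idem_conj) (use cc assms ab in \<open>auto simp: sinv_closed compatible_setD\<close>)
    finally show "(a \<cdot> b) \<cdot> sinv S (a' \<cdot> b') \<in> idems S" .
  qed
  then show ?thesis
    by (intro compatible_setI set_prod_closed c) (auto simp: set_prod_def)
qed

lemma compatible_set_sinv:
  assumes "compatible_set S A"
  shows "compatible_set S (sinv S ` A)"
  by (rule compatible_setI) (use compatible_setD[OF assms] in \<open>auto simp: sinv_closed sinv_sinv\<close>)

lemma sinv_mem_image_iff:
  assumes "A \<subseteq> carrier S" "x \<in> carrier S"
  shows "x \<in> sinv S ` A \<longleftrightarrow> sinv S x \<in> A"
  using assms sinv_sinv by (force simp: image_iff)

lemma sinv_sinv_image: "A \<subseteq> carrier S \<Longrightarrow> sinv S ` sinv S ` A = A"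
  by (auto simp: image_image sinv_sinv subset_iff)

lemma set_prod_comm_idems: "A \<subseteq> idems S \<Longrightarrow> B \<subseteq> idems S \<Longrightarrow> set_prod S A B = set_prod S B A"
  unfolding set_prod_def by (rule Collect_cong) (metis idems_commute subsetD)

lemma order_ideal_sinv:
  assumes "order_ideal S A"
  shows "order_ideal S (sinv S ` A)"
proof -
  have c: "A \<subseteq> carrier S" "\<o> \<in> A" using assms by (auto simp: order_ideal_def)
  have "y \<in> sinv S ` A" if "a \<in> A" "nat_le S y (sinv S a)" for y a
    using that c order_idealD[OF assms that(1), of "sinv S y"] nat_le_sinv[OF that(2)]
      sinv_sinv[of a] nat_le_closed[OF that(2)] sinv_mem_image_iff[OF c(1)] by auto
  moreover have "\<o> \<in> sinv S ` A" using c(2) sinv_idem[OF zero_idem] by force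
  moreover have "sinv S ` A \<subseteq> carrier S" using c sinv_closed by blast
  ultimately show ?thesis unfolding order_ideal_def down_def by blast
qed

lemma order_ideal_idems: "order_ideal S (idems S)"
  unfolding order_ideal_def down_def
  using zero_idem nat_le_idem idems_closed by blast

lemma compatible_set_idems: "A \<subseteq> idems S \<Longrightarrow> compatible_set S A"
  by (rule compatible_setI) (auto simp: sinv_idem idems_closed idems_mult subset_iff)

lemma set_prod_idems:
  assumes "order_ideal S A"
  shows "set_prod S (idems S) A = A" "set_prod S A (idems S) = A"
proof -
  have c: "A \<subseteq> carrier S" using assms by (auto simp: order_ideal_def)
  have "e \<cdot> a \<in> A" "a \<cdot> e \<in> A" if "e \<in> idems S" "a \<in> A" for e a
    using that order_idealD[OF assms that(2)] nat_le_idem_mult nat_le_mult_idem c by blast+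
  moreover have "a \<in> set_prod S (idems S) A" "a \<in> set_prod S A (idems S)" if "a \<in> A" for a
    using that c set_prodI[of "a \<cdot> sinv S a" "idems S" a A] set_prodI[of a A "sinv S a \<cdot> a" "idems S"]
      sinv_mult_idems mult_sinv_assoc(3)[of a] sinv_props(2)[of a] by auto
  ultimately show "set_prod S (idems S) A = A" "set_prod S A (idems S) = A"
    by (auto simp: set_prod_def)
qed

text \<open>For b in A and d in B compatibility makes b^-1 d idempotent, so a b^-1 d lies below a.
  The case B = A gives regularity of the ideals; general B exhibits A as an idempotent multiple of
  B.\<close>

lemma set_prod_sinv_right:
  assumes A: "order_ideal S A" and B: "compatible_set S B" and AB: "A \<subseteq> B"
  shows "set_prod S (set_prod S A (sinv S ` A)) B = A"
proof
  have c: "A \<subseteq> carrier S" "B \<subseteq> carrier S"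
    using A B by (auto simp: order_ideal_def compatible_set_def)
  have "a \<cdot> sinv S b \<cdot> d \<in> A" if "a \<in> A" "b \<in> A" "d \<in> B" for a b d
  proof -
    have "sinv S b \<cdot> d \<in> idems S" using compatible_setD(1)[OF B] that AB by blast
    then have "nat_le S (a \<cdot> (sinv S b \<cdot> d)) a" using nat_le_mult_idem that c by blast
    then show ?thesis
      using order_idealD[OF A that(1)] that c mult_assoc sinv_closed by (metis subsetD)
  qed
  then show "set_prod S (set_prod S A (sinv S ` A)) B \<subseteq> A" unfolding set_prod_def by blast
  show "A \<subseteq> set_prod S (set_prod S A (sinv S ` A)) B"
  proof
    fix a assume a: "a \<in> A"
    have "a \<cdot> sinv S a \<cdot> a \<in> set_prod S (set_prod S A (sinv S ` A)) B"
      using a AB by (intro set_prodI) auto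
    then show "a \<in> set_prod S (set_prod S A (sinv S ` A)) B" using sinv_props(2) a c by auto
  qed
qed

lemma set_prod_sinv_idems:
  assumes "compatible_set S A"
  shows "set_prod S A (sinv S ` A) \<subseteq> idems S"
  using compatible_setD[OF assms] by (auto simp: set_prod_def)

section \<open>Principal order ideals\<close>

lemma down_closed: "down S a \<subseteq> carrier S"
  unfolding down_def nat_le_def by blast

lemma down_ideal:
  assumes "a \<in> carrier S"
  shows "order_ideal S (down S a)"
  using zero_nat_le assms nat_le_closed nat_le_trans
  unfolding order_ideal_def down_def by blast

lemma down_compatible:
  assumes "a \<in> carrier S"
  shows "compatible_set S (down S a)"
proof (rule compatible_setI[OF down_closed])
  fix x y assume "x \<in> down S a" "y \<in> down S a"
  then have le: "nat_le S x a" "nat_le S y a" by (auto simp: down_def)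
  show "sinv S x \<cdot> y \<in> idems S" "x \<cdot> sinv S y \<in> idems S"
    using nat_le_mult[OF nat_le_sinv[OF le(1)] le(2)] nat_le_mult[OF le(1) nat_le_sinv[OF le(2)]]
      nat_le_idem sinv_mult_idems assms by blast+
qed

lemma set_prod_down:
  assumes "a \<in> carrier S" "b \<in> carrier S"
  shows "set_prod S (down S a) (down S b) = down S (a \<cdot> b)"
proof -
  have "set_prod S (down S a) (down S b) \<subseteq> down S (a \<cdot> b)"
    using nat_le_mult by (auto simp: set_prod_def down_def)
  moreover have "down S (a \<cdot> b) \<subseteq> set_prod S (down S a) (down S b)"
  proof -
    \<comment> \<open>The subset product is itself an order ideal, so containing a b is
      enough.\<close>
    have "a \<cdot> b \<in> set_prod S (down S a) (down S b)"
      using assms nat_le_refl by (intro set_prodI) (auto simp: down_def)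
    then show ?thesis
      using order_ideal_set_prod[OF down_ideal down_ideal, of a b] assms
      unfolding order_ideal_def by blast
  qed
  ultimately show ?thesis by blast
qed

lemma down_zero: "down S \<o> = {\<o>}"
  using zero_nat_le[OF zero_closed] nat_le_antisym[of _ \<o>] zero_nat_le nat_le_closed
  unfolding down_def by blast

end

text \<open>The classical criterion: regular with commuting idempotents. If b and c are both
  inverses of a, commuting a b with a c, and b a with c a, shows that b and c are both equal to b a
  c.\<close>

lemma inverse_semigroupI:
  fixes P (structure)
  assumes closed: "\<And>a b. a \<in> carrier P \<Longrightarrow> b \<in> carrier P \<Longrightarrow> a \<cdot> b \<in> carrier P"
    and assoc: "\<And>a b c. a \<in> carrier P \<Longrightarrow> b \<in> carrier P \<Longrightarrow> c \<in> carrier P \<Longrightarrow> (a \<cdot> b) \<cdot> c = a \<cdot> (b \<cdot> c)"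
    and zero: "\<o> \<in> carrier P" "\<And>a. a \<in> carrier P \<Longrightarrow> \<o> \<cdot> a = \<o>" "\<And>a. a \<in> carrier P \<Longrightarrow> a \<cdot> \<o> = \<o>"
    and regular: "\<And>a. a \<in> carrier P \<Longrightarrow> \<exists>b \<in> carrier P. a \<cdot> b \<cdot> a = a \<and> b \<cdot> a \<cdot> b = b"
    and commute: "\<And>e f. e \<in> idems P \<Longrightarrow> f \<in> idems P \<Longrightarrow> e \<cdot> f = f \<cdot> e"
  shows "inverse_semigroup P"
proof
  fix a assume a: "a \<in> carrier P"
  show "\<exists>!b. b \<in> carrier P \<and> a \<cdot> b \<cdot> a = a \<and> b \<cdot> a \<cdot> b = b"
  proof (rule ex_ex1I)
    show "\<exists>b. b \<in> carrier P \<and> a \<cdot> b \<cdot> a = a \<and> b \<cdot> a \<cdot> b = b" using regular[OF a] by blast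
  next
    fix b c
    assume "b \<in> carrier P \<and> a \<cdot> b \<cdot> a = a \<and> b \<cdot> a \<cdot> b = b"
      and "c \<in> carrier P \<and> a \<cdot> c \<cdot> a = a \<and> c \<cdot> a \<cdot> c = c"
    then have b: "b \<in> carrier P" "a \<cdot> b \<cdot> a = a" "b \<cdot> a \<cdot> b = b"
      and c: "c \<in> carrier P" "a \<cdot> c \<cdot> a = a" "c \<cdot> a \<cdot> c = c" by auto
    have idem: "a \<cdot> b \<in> idems P" "a \<cdot> c \<in> idems P" "b \<cdot> a \<in> idems P" "c \<cdot> a \<in> idems P"
      unfolding idems_def using a b c closed assoc by (auto; metis)+
    have "b = b \<cdot> (a \<cdot> c \<cdot> a) \<cdot> b" using b c by simp
    also have "\<dots> = b \<cdot> ((a \<cdot> c) \<cdot> (a \<cdot> b))" using a b(1) c(1) by (simp add: assoc closed)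
    also have "\<dots> = b \<cdot> ((a \<cdot> b) \<cdot> (a \<cdot> c))" using commute idem by simp
    also have "\<dots> = (b \<cdot> a \<cdot> b) \<cdot> a \<cdot> c" using a b(1) c(1) by (simp add: assoc closed)
    finally have 1: "b = b \<cdot> a \<cdot> c" using b by simp
    have "c = c \<cdot> (a \<cdot> b \<cdot> a) \<cdot> c" using b c by simp
    also have "\<dots> = ((c \<cdot> a) \<cdot> (b \<cdot> a)) \<cdot> c" using a b(1) c(1) by (simp add: assoc closed)
    also have "\<dots> = ((b \<cdot> a) \<cdot> (c \<cdot> a)) \<cdot> c" using commute idem by simp
    also have "\<dots> = b \<cdot> a \<cdot> (c \<cdot> a \<cdot> c)" using a b(1) c(1) by (simp add: assoc closed)
    finally have 2: "c = b \<cdot> a \<cdot> c" using c by simp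
    show "b = c" using 1 2 by simp
  qed
qed (use assms in auto)

section \<open>Structures that agree on the carrier\<close>

text \<open>Equality of records would be too strong for the intended use: \<open>cov_closure\<close>
  cuts down to the carrier of \<open>S\<close>, whereas \<open>set_prod\<close> applied to arbitrary
  sets does not, so the two products on ideals coincide only on the carrier.\<close>

lemma
  fixes P :: "('a, 'm) zsemigroup_scheme" and Q :: "('a, 'n) zsemigroup_scheme"
  assumes carrier: "carrier Q = carrier P"
    and smult: "\<And>a b. a \<in> carrier P \<Longrightarrow> b \<in> carrier P \<Longrightarrow> a \<cdot>\<^bsub>Q\<^esub> b = a \<cdot>\<^bsub>P\<^esub> b"
    and szero: "\<o>\<^bsub>Q\<^esub> = \<o>\<^bsub>P\<^esub>"
    and P: "inverse_semigroup P"
  shows inverse_semigroup_cong: "inverse_semigroup Q"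
    and nat_le_cong: "nat_le Q a b \<longleftrightarrow> nat_le P a b"
    and compatible_set_cong: "compatible_set Q X \<longleftrightarrow> compatible_set P X"
    and is_join_cong: "is_join Q X j \<longleftrightarrow> is_join P X j"
proof -
  interpret P: inverse_semigroup P by fact
  note eq = carrier smult szero P.mult_closed
  have idems: "idems Q = idems P"
    unfolding idems_def using eq by auto
  show "inverse_semigroup Q"
  proof
    fix a assume "a \<in> carrier Q"
    then have a: "a \<in> carrier P" by (simp add: carrier)
    have "(\<lambda>b. b \<in> carrier Q \<and> a \<cdot>\<^bsub>Q\<^esub> b \<cdot>\<^bsub>Q\<^esub> a = a \<and> b \<cdot>\<^bsub>Q\<^esub> a \<cdot>\<^bsub>Q\<^esub> b = b)
        = (\<lambda>b. b \<in> carrier P \<and> a \<cdot>\<^bsub>P\<^esub> b \<cdot>\<^bsub>P\<^esub> a = a \<and> b \<cdot>\<^bsub>P\<^esub> a \<cdot>\<^bsub>P\<^esub> b = b)"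
      using a eq by (intro ext) (auto cong: conj_cong)
    with P.ex1_inverse[OF a]
    show "\<exists>!b. b \<in> carrier Q \<and> a \<cdot>\<^bsub>Q\<^esub> b \<cdot>\<^bsub>Q\<^esub> a = a \<and> b \<cdot>\<^bsub>Q\<^esub> a \<cdot>\<^bsub>Q\<^esub> b = b"
      by simp
  qed (auto simp: eq P.mult_assoc P.zero_closed P.zero_mult P.mult_zero)
  then interpret Q: inverse_semigroup Q .
  have sinv: "sinv Q a = sinv P a" if "a \<in> carrier P" for a
    by (rule Q.sinv_unique) (use that P.sinv_props[OF that] in \<open>auto simp: eq\<close>)
  show nat_le: "nat_le Q a b \<longleftrightarrow> nat_le P a b" for a b
    unfolding nat_le_def idems carrier using eq P.idems_closed by auto
  have "compatible Q a b \<longleftrightarrow> compatible P a b" if "a \<in> carrier P" "b \<in> carrier P" for a b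
    unfolding compatible_def idems using that by (simp add: sinv eq P.sinv_closed)
  then show "compatible_set Q X \<longleftrightarrow> compatible_set P X"
    unfolding compatible_set_def carrier by (auto simp: subset_iff)
  show "is_join Q X j \<longleftrightarrow> is_join P X j"
    unfolding is_join_def nat_le carrier by simp
qed

lemma pseudogroup_cong:
  fixes P :: "('a, 'm) zsemigroup_scheme" and Q :: "('a, 'n) zsemigroup_scheme"
  assumes carrier: "carrier Q = carrier P"
    and smult: "\<And>a b. a \<in> carrier P \<Longrightarrow> b \<in> carrier P \<Longrightarrow> a \<cdot>\<^bsub>Q\<^esub> b = a \<cdot>\<^bsub>P\<^esub> b"
    and szero: "\<o>\<^bsub>Q\<^esub> = \<o>\<^bsub>P\<^esub>"
    and P: "pseudogroup P"
  shows "pseudogroup Q"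
proof -
  interpret P: pseudogroup P by fact
  note cong = inverse_semigroup_cong compatible_set_cong is_join_cong
  note cong = cong[OF carrier smult szero P.inverse_semigroup_axioms]
  have img: "(\<lambda>x. s \<cdot>\<^bsub>Q\<^esub> x) ` X = (\<lambda>x. s \<cdot>\<^bsub>P\<^esub> x) ` X"
    "(\<lambda>x. x \<cdot>\<^bsub>Q\<^esub> s) ` X = (\<lambda>x. x \<cdot>\<^bsub>P\<^esub> s) ` X"
    if "s \<in> carrier P" "compatible_set P X" for s X
    using that smult by (auto simp: compatible_set_def image_iff subset_iff)
  have join: "j \<in> carrier P" if "is_join P X j" for X j
    using that by (simp add: is_join_def)
  show ?thesis
  proof (intro pseudogroup.intro pseudogroup_axioms.intro)
    show "inverse_semigroup Q" by (rule cong(1))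
    show "\<exists>u\<in>carrier Q. \<forall>a\<in>carrier Q. u \<cdot>\<^bsub>Q\<^esub> a = a \<and> a \<cdot>\<^bsub>Q\<^esub> u = a"
      using P.ex_unit by (auto simp: carrier smult)
    show "\<exists>j. is_join Q X j" if "compatible_set Q X" for X
      using that P.ex_join by (simp add: cong(2,3))
    show "is_join Q ((\<cdot>\<^bsub>Q\<^esub>) s ` X) (s \<cdot>\<^bsub>Q\<^esub> j)" "is_join Q ((\<lambda>x. x \<cdot>\<^bsub>Q\<^esub> s) ` X) (j \<cdot>\<^bsub>Q\<^esub> s)"
      if "compatible_set Q X" "is_join Q X j" "s \<in> carrier Q" for X j s
      using that P.mult_join_left P.mult_join_right join[of X j]
      by (simp_all add: cong(2,3) carrier img smult)
  qed
qed

section \<open>Closed compatible order ideals\<close>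

context coverage
begin

abbreviation cl :: "'a set \<Rightarrow> 'a set" where
  "cl A \<equiv> cov_closure S \<C> A"

lemma cl_closed: "cl A \<subseteq> carrier S"
  by (auto simp: cov_closure_def)

lemma cl_mono: "A \<subseteq> B \<Longrightarrow> cl A \<subseteq> cl B"
  unfolding cov_closure_def by blast

lemma cl_extensive: "A \<subseteq> carrier S \<Longrightarrow> A \<subseteq> cl A"
  unfolding cov_closure_def using R by blast

lemma cl_least: "A \<subseteq> U \<Longrightarrow> cov_closed S \<C> U \<Longrightarrow> cl A \<subseteq> U"
  unfolding cov_closure_def cov_closed_def by blast

text \<open>This is axiom (T): choose for each member of a cover of x a cover inside A; the union of
  the chosen covers is a cover of x inside A.\<close>

lemma cl_cov_closed: "cov_closed S \<C> (cl A)"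
  unfolding cov_closed_def
proof (intro conjI ballI impI cl_closed)
  fix x X assume x: "x \<in> carrier S" "X \<in> \<C> x" "X \<subseteq> cl A"
  have "\<forall>y\<in>X. \<exists>Y. Y \<subseteq> A \<and> Y \<in> \<C> y" using x(3) by (auto simp: cov_closure_def)
  then obtain F where F: "\<And>y. y \<in> X \<Longrightarrow> F y \<subseteq> A" "\<And>y. y \<in> X \<Longrightarrow> F y \<in> \<C> y" by metis
  have "(\<Union>y\<in>X. F y) \<in> \<C> x" by (rule T) (use x F in auto)
  moreover have "(\<Union>y\<in>X. F y) \<subseteq> A" using F by blast
  ultimately show "x \<in> cl A" using x(1) unfolding cov_closure_def by blast
qed

lemma cl_eq: "cov_closed S \<C> A \<Longrightarrow> cl A = A"
  using cl_least[of A A] cl_extensive[of A] by (auto simp: cov_closed_def)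

lemma cl_idem: "cl (cl A) = cl A"
  by (rule cl_eq[OF cl_cov_closed])

lemma cl_subset_iff:
  "A \<subseteq> carrier S \<Longrightarrow> cov_closed S \<C> U \<Longrightarrow> cl A \<subseteq> U \<longleftrightarrow> A \<subseteq> U"
  using cl_least cl_extensive by blast

text \<open>By (MS) the product of a cover of x inside A and a cover of y inside B covers x y. This
  is the multiplicative clause of the nucleus.\<close>

lemma set_prod_cl:
  assumes "A \<subseteq> carrier S" "B \<subseteq> carrier S"
  shows "set_prod S (cl A) (cl B) \<subseteq> cl (set_prod S A B)"
proof
  fix z assume "z \<in> set_prod S (cl A) (cl B)"
  then obtain x y X Y where z: "z = x \<cdot> y" "x \<in> carrier S" "y \<in> carrier S"
    and "X \<subseteq> A" "Y \<subseteq> B" and "X \<in> \<C> x" "Y \<in> \<C> y"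
    unfolding set_prod_def cov_closure_def by blast
  then have "set_prod S X Y \<subseteq> set_prod S A B" "set_prod S X Y \<in> \<C> z" "z \<in> carrier S"
    using MS set_prod_mono mult_closed by simp_all
  then show "z \<in> cl (set_prod S A B)" unfolding cov_closure_def by blast
qed

text \<open>Inner closures are invisible under an outer one. Associativity of the closed product and
  its distributivity over joins reduce in this way to subset products.\<close>

lemma cl_set_prod:
  assumes "A \<subseteq> carrier S" "B \<subseteq> carrier S"
  shows "cl (set_prod S (cl A) (cl B)) = cl (set_prod S A B)"
    and "cl (set_prod S (cl A) B) = cl (set_prod S A B)"
    and "cl (set_prod S A (cl B)) = cl (set_prod S A B)"
proof -
  have 1: "cl (set_prod S (cl A) (cl B)) \<subseteq> cl (set_prod S A B)"
    using cl_mono[OF set_prod_cl[OF assms]] cl_idem by simp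
  have 2: "cl (set_prod S A B) \<subseteq> cl (set_prod S (cl A) B)"
    "cl (set_prod S A B) \<subseteq> cl (set_prod S A (cl B))"
    "cl (set_prod S (cl A) B) \<subseteq> cl (set_prod S (cl A) (cl B))"
    "cl (set_prod S A (cl B)) \<subseteq> cl (set_prod S (cl A) (cl B))"
    by (intro cl_mono set_prod_mono cl_extensive order.refl assms)+
  show "cl (set_prod S (cl A) (cl B)) = cl (set_prod S A B)"
    "cl (set_prod S (cl A) B) = cl (set_prod S A B)"
    "cl (set_prod S A (cl B)) = cl (set_prod S A B)"
    using 1 2 by blast+
qed

text \<open>If y = e x and X covers x, then {e} X covers y by (R) and (MS), and its elements lie
  below those of X.\<close>

lemma order_ideal_cl:
  assumes "order_ideal S A"
  shows "order_ideal S (cl A)"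
proof -
  have c: "A \<subseteq> carrier S" "\<o> \<in> A" using assms by (auto simp: order_ideal_def)
  have "y \<in> cl A" if x: "x \<in> cl A" and le: "nat_le S y x" for x y
  proof -
    obtain X where X: "X \<subseteq> A" "X \<in> \<C> x" "x \<in> carrier S"
      using x by (auto simp: cov_closure_def)
    obtain e where e: "e \<in> idems S" "y = e \<cdot> x" using le by (auto simp: nat_le_def)
    have "set_prod S {e} X \<in> \<C> y" using e X MS R idems_closed by blast
    moreover have "set_prod S {e} X \<subseteq> A"
      using order_idealD[OF assms] nat_le_idem_mult[OF e(1)] X(1) c
      by (force simp: set_prod_def)
    ultimately show ?thesis using nat_le_closed[OF le] by (auto simp: cov_closure_def)
  qed
  then show ?thesis
    using c cl_extensive cl_closed unfolding order_ideal_def down_def by blast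
qed

text \<open>By (I) a cover of x inside A^-1 inverts to a cover of x^-1 inside A.\<close>

lemma cov_closed_sinv:
  assumes "cov_closed S \<C> A"
  shows "cov_closed S \<C> (sinv S ` A)"
proof -
  have c: "A \<subseteq> carrier S" using assms by (simp add: cov_closed_def)
  have "x \<in> sinv S ` A" if x: "x \<in> carrier S" "X \<in> \<C> x" "X \<subseteq> sinv S ` A" for x X
  proof -
    have "sinv S ` X \<subseteq> A" using x(3) c sinv_sinv by (auto simp: subset_iff)
    then have "sinv S x \<in> A"
      using I[OF x(1,2)] x(1) assms sinv_closed unfolding cov_closed_def by blast
    then show ?thesis using sinv_mem_image_iff c x by blast
  qed
  then show ?thesis unfolding cov_closed_def using c sinv_closed by blast
qed

end

abbreviation (in coverage) CSC :: "'a set zsemigroup" where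
  "CSC \<equiv> closed_ideal_pseudogroup S \<C>"

section \<open>The inverse semigroup of closed compatible order ideals\<close>

context idempotent_pure_coverage
begin

lemma cl_subset_idems: "A \<subseteq> idems S \<Longrightarrow> cl A \<subseteq> idems S"
  unfolding cov_closure_def using idempotent_pure by blast

text \<open>If X and Y are covers of x and y inside A, then X^-1 Y covers x^-1 y and consists of
  idempotents because A is compatible; purity makes x^-1 y idempotent. The other product is treated
  in the same way.\<close>

lemma compatible_set_cl:
  assumes "compatible_set S A"
  shows "compatible_set S (cl A)"
proof (rule compatible_setI[OF cl_closed])
  have c: "A \<subseteq> carrier S" using assms by (simp add: compatible_set_def)
  fix x y assume "x \<in> cl A" "y \<in> cl A"
  then obtain X Y where X: "X \<subseteq> A" "X \<in> \<C> x" "x \<in> carrier S" and Y: "Y \<subseteq> A" "Y \<in> \<C> y" "y \<in> carrier S"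
    by (auto simp: cov_closure_def)
  have XY: "x' \<in> A" if "x' \<in> X \<union> Y" for x' using that X Y by blast
  have "set_prod S (sinv S ` X) Y \<subseteq> idems S" "set_prod S X (sinv S ` Y) \<subseteq> idems S"
    by (auto simp: set_prod_def intro!: compatible_setD[OF assms] XY)
  moreover have "set_prod S (sinv S ` X) Y \<in> \<C> (sinv S x \<cdot> y)"
    "set_prod S X (sinv S ` Y) \<in> \<C> (x \<cdot> sinv S y)"
    by (intro MS I sinv_closed X Y)+
  ultimately show "sinv S x \<cdot> y \<in> idems S" "x \<cdot> sinv S y \<in> idems S"
    using idempotent_pure[OF mult_closed] sinv_closed X(3) Y(3) by simp_all
qed

lemma carrier_CSC:
  "A \<in> carrier CSC \<longleftrightarrow> order_ideal S A \<and> compatible_set S A \<and> cov_closed S \<C> A"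
  by (auto simp: closed_ideal_pseudogroup_def ideal_pseudogroup_def)

lemma CSC_simps [simp]:
  "A \<cdot>\<^bsub>CSC\<^esub> B = cl (set_prod S A B)" "\<o>\<^bsub>CSC\<^esub> = cl {\<o>}"
  by (simp_all add: closed_ideal_pseudogroup_def)

lemma CSC_subset: "A \<in> carrier CSC \<Longrightarrow> A \<subseteq> carrier S"
  by (simp add: carrier_CSC order_ideal_def)

lemma CSC_cl: "A \<in> carrier CSC \<Longrightarrow> cl A = A"
  by (simp add: carrier_CSC cl_eq)

lemma cl_in_CSC: "order_ideal S A \<Longrightarrow> compatible_set S A \<Longrightarrow> cl A \<in> carrier CSC"
  by (simp add: carrier_CSC order_ideal_cl compatible_set_cl cl_cov_closed)

lemma zero_ideal: "order_ideal S {\<o>}" "compatible_set S {\<o>}"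
  using down_ideal[OF zero_closed] down_compatible[OF zero_closed] by (simp_all add: down_zero)

lemma CSC_mult_closed: "A \<in> carrier CSC \<Longrightarrow> B \<in> carrier CSC \<Longrightarrow> cl (set_prod S A B) \<in> carrier CSC"
  using cl_in_CSC order_ideal_set_prod compatible_set_set_prod by (simp add: carrier_CSC)

lemma sinv_in_CSC: "A \<in> carrier CSC \<Longrightarrow> sinv S ` A \<in> carrier CSC"
  by (simp add: carrier_CSC order_ideal_sinv compatible_set_sinv cov_closed_sinv)

text \<open>Purity says precisely that E(S) is closed. It will be the identity of the
  monoid.\<close>

lemma idems_in_CSC: "idems S \<in> carrier CSC"
proof -
  have "idems S \<subseteq> carrier S" using idems_closed by blast
  then have "cl (idems S) = idems S"
    using cl_extensive[of "idems S"] cl_subset_idems[OF order.refl] by (intro equalityI)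
  then show ?thesis
    using cl_in_CSC[OF order_ideal_idems compatible_set_idems[OF order.refl]] by simp
qed

text \<open>If A is idempotent, then A A lies in A, so its elements are products compatible with
  their factors and hence idempotent; A is the closure of A A. Conversely, an order ideal A of
  idempotents satisfies A A = A already before closing.\<close>

lemma idems_CSC: "idems CSC = {A \<in> carrier CSC. A \<subseteq> idems S}"
proof (intro equalityI subsetI)
  fix A assume "A \<in> idems CSC"
  then have A: "A \<in> carrier CSC" "cl (set_prod S A A) = A" by (auto simp: idems_def)
  note cA = CSC_subset[OF A(1)]
  have sub: "set_prod S A A \<subseteq> A" using cl_extensive[OF set_prod_closed[OF cA cA]] A(2) by simp
  have "set_prod S A A \<subseteq> idems S"
  proof
    fix z assume "z \<in> set_prod S A A"
    then obtain y w where z: "z = y \<cdot> w" "y \<in> A" "w \<in> A" "z \<in> A"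
      using sub unfolding set_prod_def by blast
    have "compatible_set S A" using A(1) carrier_CSC by blast
    then have "compatible S y (y \<cdot> w)" "compatible S (y \<cdot> w) w"
      using z unfolding compatible_set_def by blast+
    with z cA show "z \<in> idems S" using idem_if_product_compatible by blast
  qed
  then have "A \<subseteq> idems S" using cl_subset_idems A(2) by metis
  with A(1) show "A \<in> {A \<in> carrier CSC. A \<subseteq> idems S}" by simp
next
  fix A assume "A \<in> {A \<in> carrier CSC. A \<subseteq> idems S}"
  then have A: "A \<in> carrier CSC" "A \<subseteq> idems S" by auto
  have oi: "order_ideal S A" using A(1) carrier_CSC by blast
  have "set_prod S A A \<subseteq> A" using set_prod_mono[OF A(2) order.refl[of A]] set_prod_idems(1)[OF oi] by simp
  moreover have "A \<subseteq> set_prod S A A"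
  proof
    fix a assume "a \<in> A"
    then show "a \<in> set_prod S A A" using set_prodI[of a A a A] A(2) idems_idem[of a] by auto
  qed
  ultimately show "A \<in> idems CSC" using A(1) CSC_cl by (simp add: idems_def)
qed

lemma CSC_sinv_right:
  assumes "A \<in> carrier CSC" "B \<in> carrier CSC" "A \<subseteq> B"
  shows "cl (set_prod S (cl (set_prod S A (sinv S ` A))) B) = A"
proof -
  note c = CSC_subset[OF assms(1)] CSC_subset[OF sinv_in_CSC[OF assms(1)]] CSC_subset[OF assms(2)]
  have "cl (set_prod S (cl (set_prod S A (sinv S ` A))) B)
      = cl (set_prod S (set_prod S A (sinv S ` A)) B)"
    by (intro cl_set_prod(2) set_prod_closed c)
  also have "set_prod S (set_prod S A (sinv S ` A)) B = A"
    using assms by (intro set_prod_sinv_right) (auto simp: carrier_CSC)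
  also have "cl A = A" using assms CSC_cl by simp
  finally show ?thesis .
qed

lemma set_prod_zero:
  assumes "A \<in> carrier CSC"
  shows "set_prod S {\<o>} A = {\<o>}" "set_prod S A {\<o>} = {\<o>}"
proof -
  have "A \<noteq> {}" "A \<subseteq> carrier S" using assms by (auto simp: carrier_CSC order_ideal_def)
  moreover have "\<o> \<cdot> a = \<o>" "a \<cdot> \<o> = \<o>" if "a \<in> A" for a
    using that calculation zero_mult mult_zero by auto
  ultimately show "set_prod S {\<o>} A = {\<o>}" "set_prod S A {\<o>} = {\<o>}"
    unfolding set_prod_def by force+
qed

lemma inverse_semigroup_CSC: "inverse_semigroup CSC"
proof (rule inverse_semigroupI)
  fix A B assume AB: "A \<in> carrier CSC" "B \<in> carrier CSC"
  then show "A \<cdot>\<^bsub>CSC\<^esub> B \<in> carrier CSC" using CSC_mult_closed by simp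
  fix C assume C: "C \<in> carrier CSC"
  note sub = AB[THEN CSC_subset] C[THEN CSC_subset]
  show "A \<cdot>\<^bsub>CSC\<^esub> B \<cdot>\<^bsub>CSC\<^esub> C = A \<cdot>\<^bsub>CSC\<^esub> (B \<cdot>\<^bsub>CSC\<^esub> C)"
    using sub by (simp add: cl_set_prod set_prod_closed set_prod_assoc)
next
  show "\<o>\<^bsub>CSC\<^esub> \<in> carrier CSC" using cl_in_CSC[OF zero_ideal] by simp
next
  fix A assume A: "A \<in> carrier CSC"
  note sub = CSC_subset[OF A] CSC_subset[OF sinv_in_CSC[OF A]]
  show "\<o>\<^bsub>CSC\<^esub> \<cdot>\<^bsub>CSC\<^esub> A = \<o>\<^bsub>CSC\<^esub>" "A \<cdot>\<^bsub>CSC\<^esub> \<o>\<^bsub>CSC\<^esub> = \<o>\<^bsub>CSC\<^esub>"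
    using cl_set_prod(2)[of "{\<o>}" A] cl_set_prod(3)[of A "{\<o>}"] sub zero_closed set_prod_zero[OF A]
    by auto
  have "A \<cdot>\<^bsub>CSC\<^esub> sinv S ` A \<cdot>\<^bsub>CSC\<^esub> A = A" using CSC_sinv_right[OF A A] by simp
  moreover have "sinv S ` A \<cdot>\<^bsub>CSC\<^esub> A \<cdot>\<^bsub>CSC\<^esub> sinv S ` A = sinv S ` A"
    using CSC_sinv_right[OF sinv_in_CSC[OF A] sinv_in_CSC[OF A]] sub by (simp add: sinv_sinv_image)
  ultimately show "\<exists>B\<in>carrier CSC. A \<cdot>\<^bsub>CSC\<^esub> B \<cdot>\<^bsub>CSC\<^esub> A = A \<and> B \<cdot>\<^bsub>CSC\<^esub> A \<cdot>\<^bsub>CSC\<^esub> B = B"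
    using sinv_in_CSC[OF A] by blast
next
  fix A B assume "A \<in> idems CSC" "B \<in> idems CSC"
  then show "A \<cdot>\<^bsub>CSC\<^esub> B = B \<cdot>\<^bsub>CSC\<^esub> A" using set_prod_comm_idems by (simp add: idems_CSC)
qed

sublocale CSC: inverse_semigroup CSC
  by (rule inverse_semigroup_CSC)

lemma sinv_CSC: "A \<in> carrier CSC \<Longrightarrow> sinv CSC A = sinv S ` A"
  by (rule CSC.sinv_unique)
    (use CSC_sinv_right[of A A] CSC_sinv_right[of "sinv S ` A" "sinv S ` A"] CSC_subset sinv_in_CSC
      in \<open>auto simp: sinv_sinv_image\<close>)

lemma nat_le_CSC: "nat_le CSC A B \<longleftrightarrow> A \<in> carrier CSC \<and> B \<in> carrier CSC \<and> A \<subseteq> B"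
proof
  assume le: "nat_le CSC A B"
  then obtain E where E: "E \<subseteq> idems S" "A = cl (set_prod S E B)"
    and AB: "A \<in> carrier CSC" "B \<in> carrier CSC"
    unfolding nat_le_def idems_CSC by auto
  have "set_prod S E B \<subseteq> B"
    using set_prod_mono[OF E(1) order.refl[of B]] set_prod_idems(1)[of B] AB carrier_CSC by auto
  then have "A \<subseteq> B" using E(2) AB carrier_CSC cl_least by simp
  then show "A \<in> carrier CSC \<and> B \<in> carrier CSC \<and> A \<subseteq> B" using AB by simp
next
  assume AB: "A \<in> carrier CSC \<and> B \<in> carrier CSC \<and> A \<subseteq> B"
  \<comment> \<open>The expected idempotent A A^-1; that E B = A uses that A lies inside the
    compatible set B.\<close>
  define E where "E = cl (set_prod S A (sinv S ` A))"
  have "E \<in> idems CSC"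
    unfolding E_def idems_CSC
    using AB CSC_mult_closed sinv_in_CSC cl_subset_idems set_prod_sinv_idems carrier_CSC by auto
  moreover have "A = E \<cdot>\<^bsub>CSC\<^esub> B" using CSC_sinv_right[of A B] AB by (simp add: E_def)
  ultimately show "nat_le CSC A B" unfolding nat_le_def using AB by blast
qed

section \<open>Compatibility and joins of closed ideals\<close>

lemma compatible_CSC:
  assumes "compatible CSC A B" "A \<in> carrier CSC" "B \<in> carrier CSC" "a \<in> A" "b \<in> B"
  shows "sinv S a \<cdot> b \<in> idems S" "a \<cdot> sinv S b \<in> idems S"
proof -
  have "cl (set_prod S (sinv S ` A) B) \<subseteq> idems S" "cl (set_prod S A (sinv S ` B)) \<subseteq> idems S"
    using assms(1) by (simp_all add: compatible_def sinv_CSC assms(2,3) idems_CSC)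
  moreover have "sinv S a \<cdot> b \<in> set_prod S (sinv S ` A) B" "a \<cdot> sinv S b \<in> set_prod S A (sinv S ` B)"
    by (intro set_prodI imageI assms)+
  moreover have "set_prod S (sinv S ` A) B \<subseteq> carrier S" "set_prod S A (sinv S ` B) \<subseteq> carrier S"
    by (intro set_prod_closed CSC_subset sinv_in_CSC assms)+
  ultimately show "sinv S a \<cdot> b \<in> idems S" "a \<cdot> sinv S b \<in> idems S"
    by (meson cl_extensive subsetD)+
qed

text \<open>Serves to show that the ideals generated by the elements of a single closed ideal form a
  compatible family.\<close>

lemma compatible_CSC_I:
  assumes "A \<in> carrier CSC" "B \<in> carrier CSC" "compatible_set S C" "A \<subseteq> C" "B \<subseteq> C"
  shows "compatible CSC A B"
proof -
  have "set_prod S (sinv S ` A) B \<subseteq> idems S" "set_prod S A (sinv S ` B) \<subseteq> idems S"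
    using assms(4,5) by (auto simp: set_prod_def intro!: compatible_setD[OF assms(3)])
  then show ?thesis
    by (simp add: compatible_def sinv_CSC assms(1,2) idems_CSC CSC_mult_closed sinv_in_CSC
        cl_subset_idems)
qed

text \<open>The element \<open>\<o>\<close> is added only for the sake of the empty family.\<close>

lemma CSC_join:
  assumes "compatible_set CSC X"
  shows "is_join CSC X (cl (insert \<o> (\<Union>X)))"
proof -
  have X: "A \<in> carrier CSC" if "A \<in> X" for A using assms that by (auto simp: compatible_set_def)
  have X': "A \<subseteq> carrier S" "order_ideal S A" "compatible_set S A" if "A \<in> X" for A
    using X[OF that] by (simp_all add: CSC_subset carrier_CSC)
  define U where "U = insert \<o> (\<Union>X)"
  have U: "order_ideal S U"
    unfolding order_ideal_def
  proof (intro conjI ballI)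
    show "U \<subseteq> carrier S" using X'(1) zero_closed by (auto simp: U_def)
    show "\<o> \<in> U" by (simp add: U_def)
    show "down S x \<subseteq> U" if "x \<in> U" for x
    proof -
      consider "x = \<o>" | A where "A \<in> X" "x \<in> A" using \<open>x \<in> U\<close> by (auto simp: U_def)
      then show ?thesis
      proof cases
        case 1
        then show ?thesis by (simp add: down_zero U_def)
      next
        case 2
        then have "down S x \<subseteq> A" using X'(2) by (simp add: order_ideal_def)
        then show ?thesis using 2 by (auto simp: U_def)
      qed
    qed
  qed
  have Uc: "U \<subseteq> carrier S" using U by (simp add: order_ideal_def)
  have UX: "sinv S x \<cdot> y \<in> idems S" "x \<cdot> sinv S y \<in> idems S"
    if xy: "x \<in> \<Union>X" "y \<in> \<Union>X" for x y
  proof -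
    obtain A B where "A \<in> X" "B \<in> X" "x \<in> A" "y \<in> B" using xy by blast
    then show "sinv S x \<cdot> y \<in> idems S" "x \<cdot> sinv S y \<in> idems S"
      using compatible_CSC[of A B x y] assms by (simp_all add: compatible_set_def subset_iff)
  qed
  have "compatible_set S U"
  proof (rule compatible_setI[OF Uc])
    fix x y assume "x \<in> U" "y \<in> U"
    then have "x \<in> carrier S" "y \<in> carrier S" "x = \<o> \<or> y = \<o> \<or> x \<in> \<Union>X \<and> y \<in> \<Union>X"
      using Uc by (auto simp: U_def)
    then show "sinv S x \<cdot> y \<in> idems S" "x \<cdot> sinv S y \<in> idems S"
      by (elim disjE conjE; simp add: UX sinv_idem zero_idem zero_mult mult_zero sinv_closed del: Union_iff)+
  qed
  with U have cU: "cl U \<in> carrier CSC" by (rule cl_in_CSC)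
  have "A \<subseteq> cl U" if "A \<in> X" for A
    by (rule order.trans[OF _ cl_extensive[OF Uc]]) (use that in \<open>auto simp: U_def\<close>)
  moreover have "cl U \<subseteq> V" if V: "V \<in> carrier CSC" "\<And>A. A \<in> X \<Longrightarrow> A \<subseteq> V" for V
  proof (rule cl_least)
    show "U \<subseteq> V" using V by (auto simp: U_def carrier_CSC order_ideal_def)
    show "cov_closed S \<C> V" using V by (simp add: carrier_CSC)
  qed
  ultimately show ?thesis
    unfolding is_join_def nat_le_CSC U_def[symmetric] using cU X by simp
qed

lemma CSC_join_eq:
  "compatible_set CSC X \<Longrightarrow> is_join CSC X J \<Longrightarrow> J = cl (insert \<o> (\<Union>X))"
  using CSC_join CSC.is_join_unique by blast

text \<open>A join is the closure of a union U. Subset multiplication distributes over unions, and A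
  (cl U) and A U have the same closure, so it suffices to bound A U elementwise.\<close>

lemma pseudogroup_CSC: "pseudogroup CSC"
proof
  show "\<exists>u\<in>carrier CSC. \<forall>A\<in>carrier CSC. u \<cdot>\<^bsub>CSC\<^esub> A = A \<and> A \<cdot>\<^bsub>CSC\<^esub> u = A"
    by (rule bexI[OF _ idems_in_CSC]) (simp add: carrier_CSC set_prod_idems cl_eq)
  show "\<exists>J. is_join CSC X J" if "compatible_set CSC X" for X
    using CSC_join[OF that] by blast
next
  fix X J A
  assume X: "compatible_set CSC X" and J: "is_join CSC X J" and A: "A \<in> carrier CSC"
  define U where "U = insert \<o> (\<Union>X)"
  have JU: "J = cl U" using CSC_join_eq X J by (simp add: U_def)
  have Jc: "J \<in> carrier CSC" using J by (simp add: is_join_def)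
  have X': "B \<in> carrier CSC" "B \<subseteq> J" if "B \<in> X" for B
    using J that by (simp_all add: is_join_def nat_le_CSC)
  have le: "nat_le CSC B J" if "B \<in> X" for B
    using J that by (simp add: is_join_def)
  note Ac = CSC_subset[OF A]
  have Uc: "U \<subseteq> carrier S" using CSC_subset[OF X'(1)] zero_closed by (auto simp: U_def)
  have zero_in: "\<o> \<in> V" if "V \<in> carrier CSC" for V
    using that by (simp add: carrier_CSC order_ideal_def)
  show "is_join CSC ((\<cdot>\<^bsub>CSC\<^esub>) A ` X) (A \<cdot>\<^bsub>CSC\<^esub> J)"
    unfolding is_join_def
  proof (intro conjI ballI impI)
    show "A \<cdot>\<^bsub>CSC\<^esub> J \<in> carrier CSC" using A Jc by (rule CSC.mult_closed)
    show "nat_le CSC Z (A \<cdot>\<^bsub>CSC\<^esub> J)" if "Z \<in> (\<cdot>\<^bsub>CSC\<^esub>) A ` X" for Z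
      using that CSC.nat_le_mult[OF CSC.nat_le_refl[OF A] le] by (auto simp del: CSC_simps)
    fix V assume V: "V \<in> carrier CSC" "\<forall>Z\<in>(\<cdot>\<^bsub>CSC\<^esub>) A ` X. nat_le CSC Z V"
    \<comment> \<open>An element u of U lies in some member B, so a u is in A B and thus in V; the
      added zero only contributes the zero of \<open>S\<close>, which every ideal contains.\<close>
    have "set_prod S A U \<subseteq> V"
    proof
      fix z assume "z \<in> set_prod S A U"
      then obtain a u where z: "z = a \<cdot> u" "a \<in> A" "u \<in> U" by (auto simp: set_prod_def)
      show "z \<in> V"
      proof (cases "u = \<o>")
        case True
        then show ?thesis using z Ac mult_zero zero_in V by auto
      next
        case False
        then obtain B where B: "B \<in> X" "u \<in> B" using z by (auto simp: U_def)
        have "z \<in> set_prod S A B" using z B set_prodI by simp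
        moreover have "set_prod S A B \<subseteq> carrier S" by (intro set_prod_closed Ac CSC_subset X' B)
        moreover have "cl (set_prod S A B) \<subseteq> V" using V B by (auto simp: nat_le_CSC)
        ultimately show ?thesis by (meson cl_extensive subsetD)
      qed
    qed
    then have "cl (set_prod S A U) \<subseteq> V" using V cl_least by (simp add: carrier_CSC)
    then have "A \<cdot>\<^bsub>CSC\<^esub> J \<subseteq> V" using cl_set_prod(3)[OF Ac Uc] JU by simp
    then show "nat_le CSC (A \<cdot>\<^bsub>CSC\<^esub> J) V" using CSC.mult_closed[OF A Jc] V by (simp add: nat_le_CSC)
  qed
  show "is_join CSC ((\<lambda>B. B \<cdot>\<^bsub>CSC\<^esub> A) ` X) (J \<cdot>\<^bsub>CSC\<^esub> A)"
    unfolding is_join_def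
  proof (intro conjI ballI impI)
    show "J \<cdot>\<^bsub>CSC\<^esub> A \<in> carrier CSC" using Jc A by (rule CSC.mult_closed)
    show "nat_le CSC Z (J \<cdot>\<^bsub>CSC\<^esub> A)" if "Z \<in> (\<lambda>B. B \<cdot>\<^bsub>CSC\<^esub> A) ` X" for Z
      using that CSC.nat_le_mult[OF le CSC.nat_le_refl[OF A]] by (auto simp del: CSC_simps)
    fix V assume V: "V \<in> carrier CSC" "\<forall>Z\<in>(\<lambda>B. B \<cdot>\<^bsub>CSC\<^esub> A) ` X. nat_le CSC Z V"
    have "set_prod S U A \<subseteq> V"
    proof
      fix z assume "z \<in> set_prod S U A"
      then obtain a u where z: "z = u \<cdot> a" "a \<in> A" "u \<in> U" by (auto simp: set_prod_def)
      show "z \<in> V"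
      proof (cases "u = \<o>")
        case True
        then show ?thesis using z Ac zero_mult zero_in V by auto
      next
        case False
        then obtain B where B: "B \<in> X" "u \<in> B" using z by (auto simp: U_def)
        have "z \<in> set_prod S B A" using z B set_prodI by simp
        moreover have "set_prod S B A \<subseteq> carrier S" by (intro set_prod_closed Ac CSC_subset X' B)
        moreover have "cl (set_prod S B A) \<subseteq> V" using V B by (auto simp: nat_le_CSC)
        ultimately show ?thesis by (meson cl_extensive subsetD)
      qed
    qed
    then have "cl (set_prod S U A) \<subseteq> V" using V cl_least by (simp add: carrier_CSC)
    then have "J \<cdot>\<^bsub>CSC\<^esub> A \<subseteq> V" using cl_set_prod(2)[OF Uc Ac] JU by simp
    then show "nat_le CSC (J \<cdot>\<^bsub>CSC\<^esub> A) V" using CSC.mult_closed[OF Jc A] V by (simp add: nat_le_CSC)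
  qed
qed

section \<open>The canonical map into the closed ideals\<close>

lemma iota_in_CSC: "a \<in> carrier S \<Longrightarrow> cov_iota S \<C> a \<in> carrier CSC"
  unfolding cov_iota_def using cl_in_CSC down_ideal down_compatible by blast

text \<open>An upper bound of a family of such generators is therefore just a closed ideal
  containing their indices, which reduces joins of generators to membership.\<close>

lemma iota_subset_iff:
  assumes "a \<in> carrier S" "V \<in> carrier CSC"
  shows "cov_iota S \<C> a \<subseteq> V \<longleftrightarrow> a \<in> V"
proof -
  have V: "order_ideal S V" "cov_closed S \<C> V" using assms by (simp_all add: carrier_CSC)
  have "cov_iota S \<C> a \<subseteq> V \<longleftrightarrow> down S a \<subseteq> V"
    unfolding cov_iota_def by (rule cl_subset_iff[OF down_closed V(2)])
  also have "\<dots> \<longleftrightarrow> a \<in> V"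
    using V(1) nat_le_refl[OF assms(1)] by (auto simp: order_ideal_def down_def)
  finally show ?thesis .
qed

lemma cover_to_join_iota: "cover_to_join_map S \<C> CSC (cov_iota S \<C>)"
  unfolding cover_to_join_map_def semigroup_hom_def
proof (intro conjI ballI pseudogroup_CSC)
  show "cov_iota S \<C> \<in> carrier S \<rightarrow> carrier CSC" using iota_in_CSC by blast
  show "cov_iota S \<C> \<o> = \<o>\<^bsub>CSC\<^esub>" by (simp add: cov_iota_def down_zero)
next
  fix a b assume "a \<in> carrier S" "b \<in> carrier S"
  then show "cov_iota S \<C> (a \<cdot> b) = cov_iota S \<C> a \<cdot>\<^bsub>CSC\<^esub> cov_iota S \<C> b"
    by (simp add: cov_iota_def cl_set_prod(1) down_closed set_prod_down)
next
  fix a X assume a: "a \<in> carrier S" and X: "X \<in> \<C> a"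
  have Xa: "X \<subseteq> down S a" using cover_below a X by blast
  then have Xc: "x \<in> carrier S" if "x \<in> X" for x using that down_closed by blast
  \<comment> \<open>Closedness of V is exactly what is needed: V contains a cover of a, hence
    a.\<close>
  have "a \<in> V" if "V \<in> carrier CSC" "X \<subseteq> V" for V
    using that a X by (auto simp: carrier_CSC cov_closed_def)
  moreover have "X \<subseteq> cov_iota S \<C> a"
    unfolding cov_iota_def using Xa cl_extensive[OF down_closed] by blast
  ultimately show "is_join CSC (cov_iota S \<C> ` X) (cov_iota S \<C> a)"
    unfolding is_join_def nat_le_CSC using a Xc iota_in_CSC iota_subset_iff
    by (auto simp: subset_iff)
qed

text \<open>The generators are join-dense; this is the source of uniqueness in the universal
  property.\<close>

lemma iota_family_join:
  assumes "A \<in> carrier CSC"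
  shows "compatible_set CSC (cov_iota S \<C> ` A)" "is_join CSC (cov_iota S \<C> ` A) A"
proof -
  have A: "a \<in> carrier S" if "a \<in> A" for a using assms that CSC_subset by blast
  have le: "cov_iota S \<C> a \<subseteq> A" if "a \<in> A" for a using iota_subset_iff assms that A by blast
  have "compatible_set S A" using assms carrier_CSC by blast
  then have "compatible CSC (cov_iota S \<C> a) (cov_iota S \<C> b)" if "a \<in> A" "b \<in> A" for a b
    using compatible_CSC_I[OF iota_in_CSC[OF A] iota_in_CSC[OF A]] le that by blast
  then show "compatible_set CSC (cov_iota S \<C> ` A)"
    using A iota_in_CSC by (auto simp: compatible_set_def)
  show "is_join CSC (cov_iota S \<C> ` A) A"
    unfolding is_join_def nat_le_CSC using A le assms by (auto simp: iota_in_CSC iota_subset_iff)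
qed

end

section \<open>Homomorphisms, compatibility and products of joins\<close>

lemma
  fixes S :: "('a, 'm) zsemigroup_scheme" and T :: "('b, 'n) zsemigroup_scheme"
  assumes S: "inverse_semigroup S" and T: "inverse_semigroup T" and hom: "semigroup_hom S T f"
  shows hom_idem: "e \<in> idems S \<Longrightarrow> f e \<in> idems T"
    and hom_compatible: "compatible_set S A \<Longrightarrow> compatible_set T (f ` A)"
proof -
  interpret S: inverse_semigroup S by fact
  interpret T: inverse_semigroup T by fact
  have f: "f (a \<cdot>\<^bsub>S\<^esub> b) = f a \<cdot>\<^bsub>T\<^esub> f b" if "a \<in> carrier S" "b \<in> carrier S" for a b
    using that hom by (auto simp: semigroup_hom_def)
  have f_closed: "f a \<in> carrier T" if "a \<in> carrier S" for a
    using that hom by (auto simp: semigroup_hom_def)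
  show idem: "f e \<in> idems T" if "e \<in> idems S" for e
    using that f[of e e] f_closed by (simp add: idems_def)
  \<comment> \<open>Inverses are defined by equations and are unique, so they are preserved
    automatically, and compatibility with them.\<close>
  have inv: "f (sinv S a) = sinv T (f a)" if a: "a \<in> carrier S" for a
  proof (rule T.sinv_unique[symmetric])
    show "f a \<cdot>\<^bsub>T\<^esub> f (sinv S a) \<cdot>\<^bsub>T\<^esub> f a = f a"
      using S.sinv_props[OF a] a f S.mult_closed by metis
    show "f (sinv S a) \<cdot>\<^bsub>T\<^esub> f a \<cdot>\<^bsub>T\<^esub> f (sinv S a) = f (sinv S a)"
      using S.sinv_props[OF a] a f S.mult_closed by metis
  qed (use f_closed a S.sinv_closed in auto)
  assume A: "compatible_set S A"
  have Ac: "a \<in> carrier S" if "a \<in> A" for a using A that by (auto simp: compatible_set_def)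
  have "sinv T (f a) \<cdot>\<^bsub>T\<^esub> f b = f (sinv S a \<cdot>\<^bsub>S\<^esub> b)" "f a \<cdot>\<^bsub>T\<^esub> sinv T (f b) = f (a \<cdot>\<^bsub>S\<^esub> sinv S b)"
    if "a \<in> A" "b \<in> A" for a b
    using that by (simp_all add: Ac f inv S.sinv_closed)
  then show "compatible_set T (f ` A)"
    by (intro T.compatible_setI) (auto simp: S.compatible_setD[OF A] idem Ac f_closed)
qed

lemma hom_nat_le:
  assumes "semigroup_hom S T f" "inverse_semigroup S" "inverse_semigroup T" "nat_le S a b"
  shows "nat_le T (f a) (f b)"
proof -
  obtain e where e: "e \<in> idems S" "a = e \<cdot>\<^bsub>S\<^esub> b" "a \<in> carrier S" "b \<in> carrier S"
    using assms(4) by (auto simp: nat_le_def)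
  have "f a \<in> carrier T" "f b \<in> carrier T"
    using e(3,4) assms(1) by (auto simp: semigroup_hom_def)
  moreover have "f a = f e \<cdot>\<^bsub>T\<^esub> f b"
    using e assms(1) by (simp add: semigroup_hom_def idems_def)
  ultimately show ?thesis using hom_idem[OF assms(2,3,1) e(1)] by (auto simp: nat_le_def)
qed

text \<open>Distributivity is used one factor at a time: an upper bound of all a b is above each a
  k, hence above j k.\<close>

lemma (in pseudogroup) is_join_set_prod:
  assumes "compatible_set S A" "compatible_set S B" "is_join S A j" "is_join S B k"
  shows "is_join S (set_prod S A B) (j \<cdot> k)"
proof -
  have jk: "j \<in> carrier S" "k \<in> carrier S" using assms by (auto simp: is_join_def)
  have A: "a \<in> carrier S" if "a \<in> A" for a using assms(1) that by (auto simp: compatible_set_def)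
  have right: "is_join S ((\<lambda>a. a \<cdot> k) ` A) (j \<cdot> k)" using mult_join_right assms jk by blast
  have left: "is_join S ((\<lambda>b. a \<cdot> b) ` B) (a \<cdot> k)" if "a \<in> A" for a
    using mult_join_left assms that A by blast
  show ?thesis
    unfolding is_join_def
  proof (intro conjI ballI impI)
    show "j \<cdot> k \<in> carrier S" using jk mult_closed by blast
    show "nat_le S z (j \<cdot> k)" if "z \<in> set_prod S A B" for z
      using that assms nat_le_mult by (auto simp: is_join_def set_prod_def)
    fix u assume u: "u \<in> carrier S" "\<forall>z\<in>set_prod S A B. nat_le S z u"
    have "nat_le S (a \<cdot> k) u" if "a \<in> A" for a
      using left[OF that] u that set_prodI[of a A _ B] by (auto simp: is_join_def)
    then show "nat_le S (j \<cdot> k) u" using right u by (auto simp: is_join_def)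
  qed
qed

section \<open>The universal property\<close>

locale cover_to_join = idempotent_pure_coverage S \<C> + T: pseudogroup T
  for S :: "('a, 'm) zsemigroup_scheme" (structure) and \<C>
    and T :: "('b, 'n) zsemigroup_scheme" +
  fixes \<theta>
  assumes cover_to_join_map: "cover_to_join_map S \<C> T \<theta>"
begin

lemma hom: "semigroup_hom S T \<theta>"
  using cover_to_join_map by (simp add: cover_to_join_map_def)

lemma is_join_cover: "a \<in> carrier S \<Longrightarrow> X \<in> \<C> a \<Longrightarrow> is_join T (\<theta> ` X) (\<theta> a)"
  using cover_to_join_map by (simp add: cover_to_join_map_def)

lemma theta_closed: "a \<in> carrier S \<Longrightarrow> \<theta> a \<in> carrier T"
  using hom by (auto simp: semigroup_hom_def)

lemma theta_nat_le: "nat_le S a b \<Longrightarrow> nat_le T (\<theta> a) (\<theta> b)"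
  by (rule hom_nat_le[OF hom inverse_semigroup_axioms T.inverse_semigroup_axioms])

lemma theta_compatible: "compatible_set S A \<Longrightarrow> compatible_set T (\<theta> ` A)"
  by (rule hom_compatible[OF inverse_semigroup_axioms T.inverse_semigroup_axioms hom])

lemma upper_bound_cl:
  assumes "u \<in> carrier T" "\<forall>a\<in>A. nat_le T (\<theta> a) u"
  shows "\<forall>a\<in>cl A. nat_le T (\<theta> a) u"
proof
  fix x assume "x \<in> cl A"
  then obtain X where X: "X \<subseteq> A" "X \<in> \<C> x" "x \<in> carrier S" by (auto simp: cov_closure_def)
  have "\<forall>z\<in>\<theta> ` X. nat_le T z u" using X(1) assms(2) by auto
  then show "nat_le T (\<theta> x) u"
    using is_join_cover[OF X(3,2)] assms(1) by (simp add: is_join_def)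
qed

lemma is_join_cl_iff:
  assumes "A \<subseteq> carrier S"
  shows "is_join T (\<theta> ` cl A) j \<longleftrightarrow> is_join T (\<theta> ` A) j"
proof -
  have "(\<forall>z\<in>\<theta> ` cl A. nat_le T z u) \<longleftrightarrow> (\<forall>z\<in>\<theta> ` A. nat_le T z u)" if "u \<in> carrier T" for u
    using upper_bound_cl[OF that, of A] cl_extensive[OF assms] by auto
  then show ?thesis by (auto simp: is_join_def)
qed

text \<open>Joins are unique by antisymmetry, so the description is determined once a join exists.
  The restriction fixes the values off the carrier, where a morphism is unconstrained; uniqueness as
  a function needs this.\<close>

definition ext :: "'a set \<Rightarrow> 'b" where
  "ext = restrict (\<lambda>A. THE j. is_join T (\<theta> ` A) j) (carrier CSC)"

lemma is_join_ext:
  assumes "A \<in> carrier CSC"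
  shows "is_join T (\<theta> ` A) (ext A)"
proof -
  have "\<exists>j. is_join T (\<theta> ` A) j"
    using T.ex_join theta_compatible assms carrier_CSC by blast
  then have "\<exists>!j. is_join T (\<theta> ` A) j" using T.is_join_unique by blast
  then show ?thesis using theI' assms by (simp add: ext_def)
qed

lemma ext_eqI: "A \<in> carrier CSC \<Longrightarrow> is_join T (\<theta> ` A) j \<Longrightarrow> ext A = j"
  using is_join_ext T.is_join_unique by blast

lemma ext_closed: "A \<in> carrier CSC \<Longrightarrow> ext A \<in> carrier T"
  using is_join_ext by (simp add: is_join_def)

text \<open>Before closing, \<open>\<theta> a\<close> is the greatest element of the image of the
  principal ideal of a, hence its join.\<close>

lemma ext_iota:
  assumes "a \<in> carrier S"
  shows "ext (cov_iota S \<C> a) = \<theta> a"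
proof (rule ext_eqI[OF iota_in_CSC[OF assms]])
  have "a \<in> down S a" using nat_le_refl assms by (simp add: down_def)
  then have "is_join T (\<theta> ` down S a) (\<theta> a)"
    using theta_nat_le theta_closed assms by (auto simp: is_join_def down_def)
  then show "is_join T (\<theta> ` cov_iota S \<C> a) (\<theta> a)"
    unfolding cov_iota_def by (simp add: is_join_cl_iff down_closed)
qed

text \<open>The image of A B is the product of the images, and in \<open>T\<close> the join of a
  product of compatible sets is the product of the joins.\<close>

lemma ext_mult:
  assumes "A \<in> carrier CSC" "B \<in> carrier CSC"
  shows "ext (A \<cdot>\<^bsub>CSC\<^esub> B) = ext A \<cdot>\<^bsub>T\<^esub> ext B"
proof (rule ext_eqI[OF CSC.mult_closed[OF assms]])
  have c: "A \<subseteq> carrier S" "B \<subseteq> carrier S" using assms by (simp_all add: CSC_subset)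
  have "\<theta> ` set_prod S A B = set_prod T (\<theta> ` A) (\<theta> ` B)"
  proof -
    have m: "\<theta> (a \<cdot> b) = \<theta> a \<cdot>\<^bsub>T\<^esub> \<theta> b" if "a \<in> A" "b \<in> B" for a b
      using that hom c by (simp add: semigroup_hom_def subset_iff)
    then show ?thesis unfolding set_prod_def by (auto simp: image_iff) (metis m)+
  qed
  moreover have "is_join T (set_prod T (\<theta> ` A) (\<theta> ` B)) (ext A \<cdot>\<^bsub>T\<^esub> ext B)"
    by (intro T.is_join_set_prod is_join_ext theta_compatible assms)
      (use assms in \<open>simp_all add: carrier_CSC\<close>)
  ultimately show "is_join T (\<theta> ` (A \<cdot>\<^bsub>CSC\<^esub> B)) (ext A \<cdot>\<^bsub>T\<^esub> ext B)"
    using is_join_cl_iff[OF set_prod_closed[OF c]] by simp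
qed

lemma ext_join:
  assumes X: "compatible_set CSC X" and J: "is_join CSC X J"
  shows "is_join T (ext ` X) (ext J)"
proof -
  define U where "U = insert \<o> (\<Union>X)"
  have JU: "J = cl U" using CSC_join_eq[OF X J] by (simp add: U_def)
  have Jc: "J \<in> carrier CSC" using J by (simp add: is_join_def)
  have X': "A \<in> carrier CSC" "A \<subseteq> J" if "A \<in> X" for A
    using J that by (simp_all add: is_join_def nat_le_CSC)
  have Uc: "U \<subseteq> carrier S" using CSC_subset[OF X'(1)] zero_closed by (auto simp: U_def)
  have joinU: "is_join T (\<theta> ` U) (ext J)"
    using is_join_ext[OF Jc] is_join_cl_iff[OF Uc] JU by simp
  have zero: "\<theta> \<o> = \<o>\<^bsub>T\<^esub>" using hom by (simp add: semigroup_hom_def)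
  show ?thesis
    unfolding is_join_def
  proof (intro conjI ballI impI)
    show "ext J \<in> carrier T" using Jc by (rule ext_closed)
    show "nat_le T z (ext J)" if z: "z \<in> ext ` X" for z
    proof -
      obtain A where A: "A \<in> X" "z = ext A" using z by blast
      have "nat_le T (\<theta> a) (ext J)" if "a \<in> A" for a
        using is_join_ext[OF Jc] that X'(2)[OF A(1)] by (auto simp: is_join_def)
      then show ?thesis
        using is_join_ext[OF X'(1)[OF A(1)]] ext_closed[OF Jc] A(2) by (simp add: is_join_def)
    qed
    fix u assume u: "u \<in> carrier T" "\<forall>z\<in>ext ` X. nat_le T z u"
    \<comment> \<open>The zero added to the union maps to the zero of \<open>T\<close>, which lies
      below every u; this also settles the empty family.\<close>
    have "nat_le T (\<theta> x) u" if x: "x \<in> U" for x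
    proof (cases "x = \<o>")
      case True
      then show ?thesis using zero T.zero_nat_le u by simp
    next
      case False
      then obtain A where A: "A \<in> X" "x \<in> A" using x by (auto simp: U_def)
      then have "nat_le T (\<theta> x) (ext A)" using is_join_ext[OF X'(1)] by (auto simp: is_join_def)
      then show ?thesis using u A T.nat_le_trans by blast
    qed
    then show "nat_le T (ext J) u" using joinU u by (auto simp: is_join_def)
  qed
qed

lemma morphism_ext: "pseudogroup_morphism CSC T ext"
  unfolding pseudogroup_morphism_def semigroup_hom_def
proof (intro conjI allI impI ballI pseudogroup_CSC T.pseudogroup_axioms)
  show "ext \<in> carrier CSC \<rightarrow> carrier T" using ext_closed by blast
  have "\<theta> \<o> = \<o>\<^bsub>T\<^esub>" using hom by (simp add: semigroup_hom_def)
  then show "ext \<o>\<^bsub>CSC\<^esub> = \<o>\<^bsub>T\<^esub>"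
    using ext_iota[OF zero_closed] by (simp add: cov_iota_def down_zero)
qed (use ext_mult ext_join in auto)

lemma morphism_unique:
  assumes "\<phi> \<in> extensional (carrier CSC)" "pseudogroup_morphism CSC T \<phi>"
    and iota: "\<forall>s\<in>carrier S. \<phi> (cov_iota S \<C> s) = \<theta> s"
  shows "\<phi> = ext"
proof (rule extensionalityI[OF assms(1)])
  show "ext \<in> extensional (carrier CSC)" by (simp add: ext_def)
  fix A assume A: "A \<in> carrier CSC"
  have "is_join T (\<phi> ` cov_iota S \<C> ` A) (\<phi> A)"
    using assms(2) iota_family_join[OF A] unfolding pseudogroup_morphism_def by blast
  moreover have "\<phi> ` cov_iota S \<C> ` A = \<theta> ` A"
    unfolding image_image using iota CSC_subset[OF A] by (intro image_cong) (simp_all add: subset_iff)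
  ultimately show "\<phi> A = ext A" using ext_eqI[OF A] by simp
qed

end

section \<open>The trivial coverage\<close>

context inverse_semigroup
begin

text \<open>With {a} as the only cover of a, purity is a tautology and the closure operator fixes
  every subset of the carrier. All results on closed ideals thereby apply to C(S).\<close>

lemma idempotent_pure_trivial_coverage: "idempotent_pure_coverage S (\<lambda>a. {{a}})"
proof
  fix a X and F :: "'a \<Rightarrow> 'a set"
  assume "a \<in> carrier S" "X \<in> {{a}}" "\<And>x. x \<in> X \<Longrightarrow> F x \<in> {{x}}"
  then show "(\<Union>x\<in>X. F x) \<in> {{a}}" by auto
qed (auto simp: down_def nat_le_refl set_prod_def)

lemma trivial_cov_closure: "A \<subseteq> carrier S \<Longrightarrow> cov_closure S (\<lambda>a. {{a}}) A = A"
  by (auto simp: cov_closure_def)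

lemma carrier_ideal_pseudogroup:
  "A \<in> carrier (ideal_pseudogroup S) \<longleftrightarrow> order_ideal S A \<and> compatible_set S A"
  by (simp add: ideal_pseudogroup_def)

lemma ideal_pseudogroup_trivial_coverage:
  defines "Q \<equiv> closed_ideal_pseudogroup S (\<lambda>a. {{a}})"
  shows "carrier (ideal_pseudogroup S) = carrier Q"
    and "A \<in> carrier Q \<Longrightarrow> B \<in> carrier Q \<Longrightarrow> A \<cdot>\<^bsub>ideal_pseudogroup S\<^esub> B = A \<cdot>\<^bsub>Q\<^esub> B"
    and "\<o>\<^bsub>ideal_pseudogroup S\<^esub> = \<o>\<^bsub>Q\<^esub>"
  using zero_closed set_prod_closed[of A B]
  by (auto simp: Q_def closed_ideal_pseudogroup_def ideal_pseudogroup_def cov_closed_def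
      order_ideal_def trivial_cov_closure)

lemma pseudogroup_ideal_pseudogroup: "pseudogroup (ideal_pseudogroup S)"
  by (rule pseudogroup_cong[OF ideal_pseudogroup_trivial_coverage
      idempotent_pure_coverage.pseudogroup_CSC[OF idempotent_pure_trivial_coverage]])

lemma nat_le_ideal_pseudogroup:
  "nat_le (ideal_pseudogroup S) A B \<longleftrightarrow>
    A \<in> carrier (ideal_pseudogroup S) \<and> B \<in> carrier (ideal_pseudogroup S) \<and> A \<subseteq> B"
  using nat_le_cong[OF ideal_pseudogroup_trivial_coverage
      idempotent_pure_coverage.inverse_semigroup_CSC[OF idempotent_pure_trivial_coverage]]
    idempotent_pure_coverage.nat_le_CSC[OF idempotent_pure_trivial_coverage]
  by (simp add: ideal_pseudogroup_trivial_coverage(1))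

end

text \<open>As the order of C(S) is inclusion, the clauses become extensivity, monotonicity and
  idempotence of the closure together with \<open>set_prod_cl\<close>; purity is what keeps the
  closure inside C(S).\<close>

lemma (in idempotent_pure_coverage) nucleus_cl: "nucleus (ideal_pseudogroup S) cl"
  unfolding nucleus_def
proof (intro conjI ballI impI)
  show "inverse_semigroup (ideal_pseudogroup S)"
    using pseudogroup_ideal_pseudogroup by (rule pseudogroup.axioms(1))
  then interpret C: inverse_semigroup "ideal_pseudogroup S" .
  have cl: "cl A \<in> carrier (ideal_pseudogroup S)" if "A \<in> carrier (ideal_pseudogroup S)" for A
    using that order_ideal_cl compatible_set_cl by (simp add: carrier_ideal_pseudogroup)
  have sub: "A \<subseteq> carrier S" if "A \<in> carrier (ideal_pseudogroup S)" for A
    using that by (simp add: carrier_ideal_pseudogroup order_ideal_def)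
  show "cl \<in> carrier (ideal_pseudogroup S) \<rightarrow> carrier (ideal_pseudogroup S)" using cl by blast
  fix A assume A: "A \<in> carrier (ideal_pseudogroup S)"
  show "nat_le (ideal_pseudogroup S) A (cl A)"
    using A cl cl_extensive sub by (simp add: nat_le_ideal_pseudogroup)
  show "cl (cl A) = cl A" by (rule cl_idem)
  fix B assume B: "B \<in> carrier (ideal_pseudogroup S)"
  show "nat_le (ideal_pseudogroup S) (cl A) (cl B)" if "nat_le (ideal_pseudogroup S) A B"
    using that cl cl_mono by (simp add: nat_le_ideal_pseudogroup)
  show "nat_le (ideal_pseudogroup S) (cl A \<cdot>\<^bsub>ideal_pseudogroup S\<^esub> cl B)
      (cl (A \<cdot>\<^bsub>ideal_pseudogroup S\<^esub> B))"
    unfolding nat_le_ideal_pseudogroup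
    using C.mult_closed cl A B set_prod_cl sub by (simp add: ideal_pseudogroup_def)
qed

theorem theorem4p20:
  fixes S :: "('a, 'm) zsemigroup_scheme" and \<C> :: "'a \<Rightarrow> 'a set set"
  assumes "idempotent_pure_coverage S \<C>"
  shows "pseudogroup (ideal_pseudogroup S)
    \<and> nucleus (ideal_pseudogroup S) (cov_closure S \<C>)
    \<and> cover_to_join_map S \<C> (closed_ideal_pseudogroup S \<C>) (cov_iota S \<C>)
    \<and> (\<forall>(T :: ('b, 'n) zsemigroup_scheme) \<theta>. cover_to_join_map S \<C> T \<theta> \<longrightarrow>
         (\<exists>!\<theta>'. \<theta>' \<in> extensional (carrier (closed_ideal_pseudogroup S \<C>))
            \<and> pseudogroup_morphism (closed_ideal_pseudogroup S \<C>) T \<theta>'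
            \<and> (\<forall>s \<in> carrier S. \<theta>' (cov_iota S \<C> s) = \<theta> s)))"
proof (intro conjI allI impI)
  interpret idempotent_pure_coverage S \<C> by fact
  show "pseudogroup (ideal_pseudogroup S)" by (rule pseudogroup_ideal_pseudogroup)
  show "nucleus (ideal_pseudogroup S) (cov_closure S \<C>)" by (rule nucleus_cl)
  show "cover_to_join_map S \<C> (closed_ideal_pseudogroup S \<C>) (cov_iota S \<C>)"
    by (rule cover_to_join_iota)
  fix T :: "('b, 'n) zsemigroup_scheme" and \<theta>
  assume \<theta>: "cover_to_join_map S \<C> T \<theta>"
  then have "pseudogroup T" by (simp add: cover_to_join_map_def)
  then interpret cover_to_join S \<C> T \<theta>
    by (intro cover_to_join.intro cover_to_join_axioms.intro assms \<theta>)
  show "\<exists>!\<theta>'. \<theta>' \<in> extensional (carrier (closed_ideal_pseudogroup S \<C>))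
            \<and> pseudogroup_morphism (closed_ideal_pseudogroup S \<C>) T \<theta>'
            \<and> (\<forall>s \<in> carrier S. \<theta>' (cov_iota S \<C> s) = \<theta> s)"
  proof (rule ex1I[of _ ext])
    show "ext \<in> extensional (carrier CSC) \<and> pseudogroup_morphism CSC T ext
        \<and> (\<forall>s\<in>carrier S. ext (cov_iota S \<C> s) = \<theta> s)"
      using morphism_ext ext_iota by (simp add: ext_def)
  qed (use morphism_unique in blast)
qed

end
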